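(* Let $I$ be a non-empty set. Then $M_{I}(\mathbb{C})$ is strong pseudo-amenable if and only if $I$ is finite.
   Context: $M_I(\mathbb{C})$ is the Banach algebra of $I\times I$ complex matrices $(a_{i,j})$ with finite $\ell^1$-norm $\sum_{i,j}|a_{i,j}|<\infty$ and matrix multiplication. Strong pseudo-amenability: for a (complex) Banach algebra $A$, $A\otimes_p A$ is the projective tensor product, a Banach $A$-bimodule via $a\cdot(b\otimes c)=ab\otimes c$, $(b\otimes c)\cdot a=b\otimes ca$; $\pi_A:A\otimes_pA\to A$ is the bounded linear map with $\pi_A(a\otimes b)=ab$. For a Banach $A$-bimodule $X$, $X^*$ is a Banach $A$-bimodule via $(a\cdot f)(x)=f(x\cdot a)$, $(f\cdot a)(x)=f(a\cdot x)$; iterating, $(A\otimes_pA)^{**}$ and $A^{**}$ are Banach $A$-bimodules, and $A\subseteq A^{**}$ canonically. $A$ is strong pseudo-amenable if there is a (not necessarily bounded) net $(m_\alpha)$ in $(A\otimes_pA)^{**}$ such that for every $a\in A$: $a\cdot m_\alpha-m_\alpha\cdot a\to 0$ in norm, $a\,\pi_A^{**}(m_\alpha)=\pi_A^{**}(m_\alpha)\,a$ for all $\alpha$, and $\pi_A^{**}(m_\alpha)\,a\to a$ in norm. *)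

theory Defs
  imports "HOL-Analysis.Analysis" "HOL-Library.Multiset"
begin

section \<open>Complex Banach spaces and Banach algebras\<close>

class scaleC =
  fixes scaleC :: "complex \<Rightarrow> 'a \<Rightarrow> 'a"  (infixr \<open>*\<^sub>C\<close> 75)

class complex_vector = real_vector + scaleC +
  assumes scaleC_add_right: "c *\<^sub>C (x + y) = c *\<^sub>C x + c *\<^sub>C y"
    and scaleC_add_left: "(c + d) *\<^sub>C x = c *\<^sub>C x + d *\<^sub>C x"
    and scaleC_scaleC: "c *\<^sub>C d *\<^sub>C x = (c * d) *\<^sub>C x"
    and scaleC_one: "1 *\<^sub>C x = x"
    and scaleR_scaleC: "r *\<^sub>R x = complex_of_real r *\<^sub>C x"

class complex_normed_vector = complex_vector + real_normed_vector +
  assumes norm_scaleC: "norm (c *\<^sub>C x) = cmod c * norm x"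

class complex_banach = complex_normed_vector + complete_space

subclass (in complex_banach) banach ..

class complex_normed_algebra = complex_normed_vector + real_normed_algebra +
  assumes mult_scaleC_left: "(c *\<^sub>C x) * y = c *\<^sub>C (x * y)"
    and mult_scaleC_right: "x * (c *\<^sub>C y) = c *\<^sub>C (x * y)"

class complex_banach_algebra = complex_normed_algebra + complete_space

subclass (in complex_banach_algebra) complex_banach ..

lemma scaleC_zero_left [simp]: "0 *\<^sub>C x = (0 :: 'a::complex_vector)"
  using scaleC_add_left[of 0 0 x] by simp

lemma scaleC_zero_right [simp]: "c *\<^sub>C 0 = (0 :: 'a::complex_vector)"
  using scaleC_add_right[of c 0 0] by simp

lemma scaleC_minus_one: "(-1) *\<^sub>C x = - (x :: 'a::complex_vector)"
  using scaleR_scaleC[of "-1" x] by simp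

lemma scaleC_minus_right: "c *\<^sub>C (- x) = - (c *\<^sub>C (x :: 'a::complex_vector))"
  using scaleC_add_right[of c "x" "- x"] by (simp add: eq_neg_iff_add_eq_0 add.commute)

lemma scaleC_diff_right: "c *\<^sub>C (x - y) = c *\<^sub>C x - c *\<^sub>C (y :: 'a::complex_vector)"
  using scaleC_add_right[of c x "- y"] by (simp add: scaleC_minus_right)

instantiation complex :: complex_banach
begin
definition scaleC_complex :: "complex \<Rightarrow> complex \<Rightarrow> complex" where "scaleC_complex c z = c * z"
instance
  by standard (auto simp: scaleC_complex_def algebra_simps norm_mult scaleR_conv_of_real)
end

definition bounded_clinear :: "('a::complex_normed_vector \<Rightarrow> 'b::complex_normed_vector) \<Rightarrow> bool"
  where "bounded_clinear T \<longleftrightarrow> bounded_linear T \<and> (\<forall>c x. T (c *\<^sub>C x) = c *\<^sub>C T x)"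

lemma bounded_clinearI:
  assumes "\<And>x y. T (x + y) = T x + T y" "\<And>c x. T (c *\<^sub>C x) = c *\<^sub>C T x"
    "\<And>x. norm (T x) \<le> norm x * K"
  shows "bounded_clinear T"
  unfolding bounded_clinear_def
  by (intro conjI bounded_linear_intro[of T K]) (auto simp: assms scaleR_scaleC)

lemma bounded_clinear_mult_left: "bounded_clinear (\<lambda>x. a * (x :: 'a::complex_normed_algebra))"
  by (rule bounded_clinearI[where K = "norm a"])
    (use norm_mult_ineq[of a] in \<open>auto simp: distrib_left mult_scaleC_right mult.commute[of "norm _" "norm a"]\<close>)

lemma bounded_clinear_mult_right: "bounded_clinear (\<lambda>x. (x :: 'a::complex_normed_algebra) * a)"
  by (rule bounded_clinearI[where K = "norm a"])
    (auto simp: distrib_right mult_scaleC_left norm_mult_ineq)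


section \<open>The dual space\<close>

typedef (overloaded) ('a::complex_normed_vector) cdual =
  "{f :: 'a \<Rightarrow>\<^sub>L complex. bounded_clinear (blinfun_apply f)}"
  morphisms blinfun_of_cdual Abs_cdual
  by (rule exI[of _ 0])
    (simp add: bounded_clinear_def bounded_linear_zero blinfun.bounded_linear_right)

setup_lifting type_definition_cdual

lift_definition cdual_apply :: "'a::complex_normed_vector cdual \<Rightarrow> 'a \<Rightarrow> complex" is blinfun_apply .

lemma bounded_clinear_cdual_apply: "bounded_clinear (cdual_apply f)"
  by transfer simp

lemma cdual_eqI: "(\<And>x. cdual_apply f x = cdual_apply g x) \<Longrightarrow> f = g"
  by transfer (auto intro: blinfun_eqI)

lemma bounded_clinear_blinfun_iff:
  "bounded_clinear (blinfun_apply f) \<longleftrightarrow> (\<forall>c x. f (c *\<^sub>C x) = c * f x)"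
  by (simp add: bounded_clinear_def scaleC_complex_def blinfun.bounded_linear_right)

instantiation cdual :: (complex_normed_vector) complex_normed_vector
begin

lift_definition zero_cdual :: "'a cdual" is 0
  by (simp add: bounded_clinear_blinfun_iff)

lift_definition plus_cdual :: "'a cdual \<Rightarrow> 'a cdual \<Rightarrow> 'a cdual" is "(+)"
  by (simp add: bounded_clinear_blinfun_iff blinfun.add_left algebra_simps)

lift_definition minus_cdual :: "'a cdual \<Rightarrow> 'a cdual \<Rightarrow> 'a cdual" is "(-)"
  by (simp add: bounded_clinear_blinfun_iff blinfun.diff_left algebra_simps)

lift_definition uminus_cdual :: "'a cdual \<Rightarrow> 'a cdual" is "uminus"
  by (simp add: bounded_clinear_blinfun_iff blinfun.minus_left algebra_simps)

lift_definition scaleR_cdual :: "real \<Rightarrow> 'a cdual \<Rightarrow> 'a cdual" is "(*\<^sub>R)"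
  by (simp add: bounded_clinear_blinfun_iff blinfun.scaleR_left algebra_simps)

lift_definition scaleC_cdual :: "complex \<Rightarrow> 'a cdual \<Rightarrow> 'a cdual" is
  "\<lambda>c f. blinfun_mult_left c o\<^sub>L f"
  by (simp add: bounded_clinear_blinfun_iff algebra_simps)

lift_definition norm_cdual :: "'a cdual \<Rightarrow> real" is norm .

definition sgn_cdual :: "'a cdual \<Rightarrow> 'a cdual" where "sgn_cdual f = scaleR (inverse (norm f)) f"
definition dist_cdual :: "'a cdual \<Rightarrow> 'a cdual \<Rightarrow> real" where "dist_cdual f g = norm (f - g)"
definition uniformity_cdual :: "('a cdual \<times> 'a cdual) filter" where
  "uniformity_cdual = (INF e\<in>{0 <..}. principal {(x, y). dist x y < e})"
definition open_cdual :: "'a cdual set \<Rightarrow> bool" where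
  "open_cdual S = (\<forall>x\<in>S. \<forall>\<^sub>F (x', y) in uniformity. x' = x \<longrightarrow> y \<in> S)"

instance
proof
  fix c d :: complex and f g h :: "'a cdual" and r s :: real
  show "sgn f = scaleR (inverse (norm f)) f" "dist f g = norm (f - g)"
    "(uniformity :: ('a cdual \<times> 'a cdual) filter) = (INF e\<in>{0 <..}. principal {(x, y). dist x y < e})"
    by (auto simp: sgn_cdual_def dist_cdual_def uniformity_cdual_def)
  show "open U \<longleftrightarrow> (\<forall>x\<in>U. \<forall>\<^sub>F (x', y) in uniformity. x' = x \<longrightarrow> y \<in> U)" for U :: "'a cdual set"
    by (simp add: open_cdual_def)
  show "norm (c *\<^sub>C f) = cmod c * norm f"
  proof transfer
    fix c :: complex and f :: "'a \<Rightarrow>\<^sub>L complex"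
    have le: "norm (blinfun_mult_left c o\<^sub>L f) \<le> cmod c * norm f" for c f
    proof (rule norm_blinfun_bound)
      show "cmod ((blinfun_mult_left c o\<^sub>L f) x) \<le> cmod c * norm f * norm x" for x
        using mult_left_mono[OF norm_blinfun[of f x], of "cmod c"]
        by (simp add: norm_mult mult.commute mult.left_commute)
    qed simp
    have "cmod c * norm f \<le> norm (blinfun_mult_left c o\<^sub>L f)"
    proof (cases "c = 0")
      case False
      have "norm f = norm (blinfun_mult_left (inverse c) o\<^sub>L (blinfun_mult_left c o\<^sub>L f))"
        using False by (intro arg_cong[of _ _ norm] blinfun_eqI) simp
      also have "\<dots> \<le> cmod (inverse c) * norm (blinfun_mult_left c o\<^sub>L f)" by (rule le)
      finally have "norm f \<le> cmod (inverse c) * norm (blinfun_mult_left c o\<^sub>L f)" .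
      from mult_left_mono[OF this, of "cmod c"] show ?thesis
        using False by (simp add: norm_inverse flip: mult.assoc)
    qed simp
    with le[of c f] show "norm (blinfun_mult_left c o\<^sub>L f) = cmod c * norm f" by simp
  qed
qed (transfer; force simp: blinfun.add_left blinfun.scaleR_left norm_triangle_ineq
      scaleR_conv_of_real algebra_simps intro!: blinfun_eqI)+

end

lemma cdual_apply_simps [simp]:
  "cdual_apply 0 x = 0"
  "cdual_apply (f + g) x = cdual_apply f x + cdual_apply g x"
  "cdual_apply (f - g) x = cdual_apply f x - cdual_apply g x"
  "cdual_apply (- f) x = - cdual_apply f x"
  "cdual_apply (r *\<^sub>R f) x = r *\<^sub>R cdual_apply f x"
  "cdual_apply (c *\<^sub>C f) x = c * cdual_apply f x"
  by (transfer; simp add: blinfun.bilinear_simps)+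

lemma norm_cdual_apply: "cmod (cdual_apply f x) \<le> norm f * norm x"
  by transfer (rule norm_blinfun)

lemma norm_cdual_bound:
  "0 \<le> K \<Longrightarrow> (\<And>x. cmod (cdual_apply f x) \<le> K * norm x) \<Longrightarrow> norm f \<le> K"
  by transfer (rule norm_blinfun_bound)

lemma cdual_apply_Abs: "bounded_clinear T \<Longrightarrow> cdual_apply (Abs_cdual (Blinfun T)) = T"
  by (simp add: cdual_apply.rep_eq Abs_cdual_inverse bounded_linear_Blinfun_apply
      bounded_clinear_def)

instance cdual :: (complex_normed_vector) complex_banach
proof
  fix X :: "nat \<Rightarrow> 'a cdual"
  assume X: "Cauchy X"
  have d: "dist f g = dist (blinfun_of_cdual f) (blinfun_of_cdual g)" for f g :: "'a cdual"
    by (simp add: dist_norm norm_cdual.rep_eq minus_cdual.rep_eq)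
  have "Cauchy (\<lambda>n. blinfun_of_cdual (X n))"
    using X by (simp add: Cauchy_def d)
  then obtain L where L: "(\<lambda>n. blinfun_of_cdual (X n)) \<longlonglongrightarrow> L"
    by (auto simp: Cauchy_convergent_iff convergent_def)
  have "L (c *\<^sub>C x) = c * L x" for c x
  proof (rule LIMSEQ_unique)
    show "(\<lambda>n. blinfun_of_cdual (X n) (c *\<^sub>C x)) \<longlonglongrightarrow> L (c *\<^sub>C x)"
      by (intro tendsto_intros L)
    have "(\<lambda>n. c * blinfun_of_cdual (X n) x) \<longlonglongrightarrow> c * L x"
      by (intro tendsto_intros L)
    moreover have "blinfun_of_cdual (X n) (c *\<^sub>C x) = c * blinfun_of_cdual (X n) x" for n
      using blinfun_of_cdual[of "X n"] by (simp add: bounded_clinear_blinfun_iff)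
    ultimately show "(\<lambda>n. blinfun_of_cdual (X n) (c *\<^sub>C x)) \<longlonglongrightarrow> c * L x" by simp
  qed
  then have "blinfun_of_cdual (Abs_cdual L) = L"
    by (intro Abs_cdual_inverse) (simp add: bounded_clinear_blinfun_iff)
  then have "X \<longlonglongrightarrow> Abs_cdual L"
    using L by (simp add: tendsto_iff d)
  then show "convergent X" by (auto simp: convergent_def)
qed

text \<open>The canonical embedding into the bidual and the transpose of a bounded operator.\<close>

definition bidual_embed :: "'a::complex_normed_vector \<Rightarrow> 'a cdual cdual"
  where "bidual_embed x = Abs_cdual (Blinfun (\<lambda>f. cdual_apply f x))"

lemma cdual_apply_bidual_embed [simp]: "cdual_apply (bidual_embed x) f = cdual_apply f x"
proof -
  have "bounded_clinear (\<lambda>f. cdual_apply f x)"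
    by (rule bounded_clinearI[where K = "norm x"]) (auto simp: scaleC_complex_def norm_cdual_apply)
  then show ?thesis by (simp add: bidual_embed_def cdual_apply_Abs)
qed

text \<open>Meaningful only for \<^term>\<open>bounded_clinear T\<close>; all uses below are of this kind.\<close>

definition transposed ::
  "('a::complex_normed_vector \<Rightarrow> 'b::complex_normed_vector) \<Rightarrow> 'b cdual \<Rightarrow> 'a cdual"
  where "transposed T f = Abs_cdual (Blinfun (\<lambda>x. cdual_apply f (T x)))"

lemma cdual_apply_transposed:
  assumes "bounded_clinear T"
  shows "cdual_apply (transposed T f) x = cdual_apply f (T x)"
proof -
  have "bounded_clinear (\<lambda>x. cdual_apply f (T x))"
    using assms bounded_clinear_cdual_apply[of f]
    by (auto simp: bounded_clinear_def intro: bounded_linear_compose)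
  then show ?thesis by (simp add: transposed_def cdual_apply_Abs)
qed

lemma bounded_clinear_transposed:
  assumes "bounded_clinear T"
  shows "bounded_clinear (transposed T)"
proof (rule bounded_clinearI)
  show "transposed T (f + g) = transposed T f + transposed T g" for f g
    by (rule cdual_eqI) (simp add: cdual_apply_transposed assms)
  show "transposed T (c *\<^sub>C f) = c *\<^sub>C transposed T f" for c f
    by (rule cdual_eqI) (simp add: cdual_apply_transposed assms)
  have T: "bounded_linear T" using assms by (simp add: bounded_clinear_def)
  show "norm (transposed T f) \<le> norm f * onorm T" for f
  proof (rule norm_cdual_bound)
    show "cmod (cdual_apply (transposed T f) x) \<le> norm f * onorm T * norm x" for x
    proof -
      have "cmod (cdual_apply (transposed T f) x) \<le> norm f * norm (T x)"
        by (simp add: cdual_apply_transposed assms norm_cdual_apply)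
      also have "\<dots> \<le> norm f * (onorm T * norm x)"
        by (intro mult_left_mono onorm T) simp
      finally show ?thesis by (simp add: mult.assoc)
    qed
  qed (simp add: onorm_pos_le T)
qed


section \<open>The projective tensor product\<close>

text \<open>
  The algebraic tensor product is the free commutative monoid on \<open>A \<times> B\<close> modulo the congruence
  generated by complex bilinearity; \<open>{#(a\<^sub>1, b\<^sub>1), \<dots>, (a\<^sub>n, b\<^sub>n)#}\<close> stands for
  \<open>a\<^sub>1 \<otimes> b\<^sub>1 + \<dots> + a\<^sub>n \<otimes> b\<^sub>n\<close>. The last rule makes the quotient a group, as
  \<open>a \<otimes> b + (-a) \<otimes> b = 0 \<otimes> b\<close>.
\<close>

inductive tensor_cong ::
  "('a::complex_vector \<times> 'b::complex_vector) multiset \<Rightarrow> ('a \<times> 'b) multiset \<Rightarrow> bool"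
  where
    tensor_refl: "tensor_cong M M"
  | tensor_sym: "tensor_cong M N \<Longrightarrow> tensor_cong N M"
  | tensor_trans: "tensor_cong M N \<Longrightarrow> tensor_cong N P \<Longrightarrow> tensor_cong M P"
  | tensor_add: "tensor_cong M N \<Longrightarrow> tensor_cong M' N' \<Longrightarrow> tensor_cong (M + M') (N + N')"
  | tensor_add_left: "tensor_cong {#(a + a', b)#} {#(a, b), (a', b)#}"
  | tensor_add_right: "tensor_cong {#(a, b + b')#} {#(a, b), (a, b')#}"
  | tensor_scale: "tensor_cong {#(c *\<^sub>C a, b)#} {#(a, c *\<^sub>C b)#}"
  | tensor_zero: "tensor_cong {#(0, b)#} {#}"

lemma equivp_tensor_cong: "equivp tensor_cong"
  by (rule equivpI) (auto simp: reflp_def symp_def transp_def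
      intro: tensor_refl tensor_sym elim: tensor_trans)

quotient_type (overloaded) ('a, 'b) alg_tensor =
  "('a::complex_vector \<times> 'b::complex_vector) multiset" / tensor_cong
  by (rule equivp_tensor_cong)

lemma tensor_cong_map:
  assumes "tensor_cong M N"
    and S: "\<And>x y. S (x + y) = S x + S y" "\<And>c x. S (c *\<^sub>C x) = c *\<^sub>C S x"
    and T: "\<And>x y. T (x + y) = T x + T y" "\<And>c x. T (c *\<^sub>C x) = c *\<^sub>C T x"
  shows "tensor_cong (image_mset (map_prod S T) M) (image_mset (map_prod S T) N)"
  using assms(1)
proof induction
  case (tensor_zero b)
  have "S 0 = 0" using S(2)[of 0 0] by simp
  then show ?case by (simp add: tensor_cong.tensor_zero)
qed (auto simp: S T intro: tensor_cong.intros)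

lemma tensor_cong_neg: "tensor_cong (image_mset (map_prod uminus id) M + M) {#}"
proof (induction M)
  case (add p M)
  obtain a b where p: "p = (a, b)" by fastforce
  have "tensor_cong {#(- a, b), (a, b)#} {#}"
    using tensor_trans[OF tensor_sym[OF tensor_add_left[of "- a" a b]], of "{#}"]
    by (simp add: tensor_zero)
  from tensor_add[OF this add] show ?case by (simp add: p add_mset_commute)
qed (simp add: tensor_refl)

instantiation alg_tensor :: (complex_vector, complex_vector) complex_vector
begin

lift_definition zero_alg_tensor :: "('a, 'b) alg_tensor" is "{#}" .

lift_definition plus_alg_tensor ::
  "('a, 'b) alg_tensor \<Rightarrow> ('a, 'b) alg_tensor \<Rightarrow> ('a, 'b) alg_tensor" is "(+)"
  by (rule tensor_add)

lift_definition uminus_alg_tensor :: "('a, 'b) alg_tensor \<Rightarrow> ('a, 'b) alg_tensor" is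
  "image_mset (map_prod uminus id)"
  by (erule tensor_cong_map) (auto simp: scaleC_minus_right)

definition minus_alg_tensor ::
  "('a, 'b) alg_tensor \<Rightarrow> ('a, 'b) alg_tensor \<Rightarrow> ('a, 'b) alg_tensor" where
  "minus_alg_tensor t u = t + (- u)"

lift_definition scaleC_alg_tensor :: "complex \<Rightarrow> ('a, 'b) alg_tensor \<Rightarrow> ('a, 'b) alg_tensor" is
  "\<lambda>c. image_mset (map_prod (scaleC c) id)"
  by (erule tensor_cong_map) (auto simp: scaleC_add_right scaleC_scaleC mult.commute)

definition scaleR_alg_tensor :: "real \<Rightarrow> ('a, 'b) alg_tensor \<Rightarrow> ('a, 'b) alg_tensor" where
  "scaleR_alg_tensor r t = complex_of_real r *\<^sub>C t"

instance
proof
  fix t u v :: "('a, 'b) alg_tensor" and c d :: complex and r s :: real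
  show "t + u + v = t + (u + v)" by transfer (simp add: add.assoc tensor_refl)
  show "t + u = u + t" by transfer (simp add: add.commute tensor_refl)
  show "0 + t = t" by transfer (simp add: tensor_refl)
  show "- t + t = 0" by transfer (rule tensor_cong_neg)
  show "t - u = t + - u" by (rule minus_alg_tensor_def)
  show C1: "c *\<^sub>C (t + u) = c *\<^sub>C t + c *\<^sub>C u" for c and t u :: "('a, 'b) alg_tensor" by transfer (simp add: tensor_refl)
  show C2: "(c + d) *\<^sub>C t = c *\<^sub>C t + d *\<^sub>C t" for c d and t :: "('a, 'b) alg_tensor"
  proof transfer
    fix c d :: complex and M :: "('a \<times> 'b) multiset"
    show "tensor_cong (image_mset (map_prod (scaleC (c + d)) id) M)
      (image_mset (map_prod (scaleC c) id) M + image_mset (map_prod (scaleC d) id) M)"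
    proof (induction M)
      case (add p M)
      obtain a b where p: "p = (a, b)" by fastforce
      from tensor_add[OF tensor_add_left[of "c *\<^sub>C a" "d *\<^sub>C a" b] add] show ?case
        by (simp add: p scaleC_add_left add_mset_commute)
    qed (simp add: tensor_refl)
  qed
  show C3: "c *\<^sub>C d *\<^sub>C t = (c * d) *\<^sub>C t" for c d and t :: "('a, 'b) alg_tensor"
    by transfer (simp add: multiset.map_comp o_def map_prod_def case_prod_unfold scaleC_scaleC tensor_refl)
  show C4: "1 *\<^sub>C t = t" for t :: "('a, 'b) alg_tensor"
    by transfer (simp add: map_prod_def scaleC_one tensor_refl)
  show "r *\<^sub>R t = complex_of_real r *\<^sub>C t" by (rule scaleR_alg_tensor_def)
  show "r *\<^sub>R (t + u) = r *\<^sub>R t + r *\<^sub>R u" "(r + s) *\<^sub>R t = r *\<^sub>R t + s *\<^sub>R t"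
    "r *\<^sub>R s *\<^sub>R t = (r * s) *\<^sub>R t" "1 *\<^sub>R t = t"
    by (simp_all add: scaleR_alg_tensor_def C1 C2 C3 C4)
qed

end

text \<open>
  The projective norm on the algebraic tensor product. That it is definite (and not just a
  seminorm) is not needed: the completion below divides out the null space in any case.
\<close>

definition proj_norm ::
  "('a::complex_normed_vector, 'b::complex_normed_vector) alg_tensor \<Rightarrow> real" where
  "proj_norm t = (INF M\<in>{M. abs_alg_tensor M = t}. \<Sum>(a, b)\<in>#M. norm a * norm b)"

lemma abs_alg_tensor_add: "abs_alg_tensor (M + N) = abs_alg_tensor M + abs_alg_tensor N"
  by (simp add: plus_alg_tensor.abs_eq)

lemma ex_alg_tensor_rep: "\<exists>M. abs_alg_tensor M = t"
  by (metis Quotient_alg_tensor Quotient_abs_rep)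

lemma sum_mset_norm_nonneg: "0 \<le> (\<Sum>(a, b)\<in>#M. norm a * norm b)"
  by (induction M) auto

lemma proj_norm_le: "abs_alg_tensor M = t \<Longrightarrow> proj_norm t \<le> (\<Sum>(a, b)\<in>#M. norm a * norm b)"
  unfolding proj_norm_def
  by (rule cINF_lower) (auto intro!: bdd_belowI[of _ 0] simp: sum_mset_norm_nonneg)

lemma proj_norm_greatest:
  assumes "\<And>M. abs_alg_tensor M = t \<Longrightarrow> K \<le> (\<Sum>(a, b)\<in>#M. norm a * norm b)"
  shows "K \<le> proj_norm t"
  unfolding proj_norm_def using ex_alg_tensor_rep[of t] assms by (auto intro!: cINF_greatest)

lemma proj_norm_nonneg: "0 \<le> proj_norm t"
  by (rule proj_norm_greatest) (rule sum_mset_norm_nonneg)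

lemma proj_norm_zero [simp]: "proj_norm 0 = 0"
proof (rule antisym)
  show "proj_norm (0 :: ('a, 'b) alg_tensor) \<le> 0"
    using proj_norm_le[OF zero_alg_tensor.abs_eq[symmetric]] by simp
qed (rule proj_norm_nonneg)

lemma proj_norm_approx:
  assumes "proj_norm t < K"
  obtains M where "abs_alg_tensor M = t" "(\<Sum>(a, b)\<in>#M. norm a * norm b) < K"
  using assms proj_norm_greatest[of t K] by (meson linorder_not_less)

lemma proj_norm_triangle: "proj_norm (t + u) \<le> proj_norm t + proj_norm u"
proof (rule field_le_epsilon)
  fix e :: real assume "e > 0"
  obtain M where M: "abs_alg_tensor M = t" "(\<Sum>(a, b)\<in>#M. norm a * norm b) < proj_norm t + e/2"
    using proj_norm_approx[of t "proj_norm t + e/2"] \<open>e > 0\<close> by auto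
  obtain N where N: "abs_alg_tensor N = u" "(\<Sum>(a, b)\<in>#N. norm a * norm b) < proj_norm u + e/2"
    using proj_norm_approx[of u "proj_norm u + e/2"] \<open>e > 0\<close> by auto
  have "proj_norm (t + u) \<le> (\<Sum>(a, b)\<in>#M + N. norm a * norm b)"
    by (rule proj_norm_le) (simp add: abs_alg_tensor_add M N)
  then show "proj_norm (t + u) \<le> proj_norm t + proj_norm u + e"
    using M N by simp
qed

lemma sum_mset_norm_map_le:
  assumes "\<And>x. norm (S x) \<le> K * norm x" "\<And>x. norm (T x) \<le> L * norm x" "0 \<le> K" "0 \<le> L"
  shows "(\<Sum>(a, b)\<in># image_mset (map_prod S T) M. norm a * norm b)
    \<le> K * L * (\<Sum>(a, b)\<in>#M. norm a * norm b)"
proof (induction M)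
  case (add p M)
  have "norm (S (fst p)) * norm (T (snd p)) \<le> (K * norm (fst p)) * (L * norm (snd p))"
    by (intro mult_mono assms) (auto simp: assms)
  with add show ?case by (simp add: algebra_simps case_prod_unfold)
qed simp

lemma proj_norm_map_le:
  assumes F: "\<And>M. F (abs_alg_tensor M) = abs_alg_tensor (image_mset (map_prod S T) M)"
    and "\<And>x. norm (S x) \<le> K * norm x" "\<And>x. norm (T x) \<le> L * norm x" "0 \<le> K" "0 \<le> L"
  shows "proj_norm (F t) \<le> K * L * proj_norm t"
proof (rule field_le_epsilon)
  fix e :: real assume e: "e > 0"
  have "0 \<le> K * L" using assms by simp
  define d where "d = e / (K * L + 1)"
  have d: "d > 0" "K * L * d \<le> e" using e \<open>0 \<le> K * L\<close> by (auto simp: d_def field_simps add_nonneg_pos)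
  obtain M where M: "abs_alg_tensor M = t" "(\<Sum>(a, b)\<in>#M. norm a * norm b) < proj_norm t + d"
    using proj_norm_approx[of t "proj_norm t + d"] d by auto
  have "proj_norm (F t) \<le> (\<Sum>(a, b)\<in># image_mset (map_prod S T) M. norm a * norm b)"
    by (rule proj_norm_le) (simp add: F M(1)[symmetric])
  also have "\<dots> \<le> K * L * (\<Sum>(a, b)\<in>#M. norm a * norm b)"
    by (rule sum_mset_norm_map_le) (auto simp: assms)
  also have "\<dots> \<le> K * L * (proj_norm t + d)"
    using M(2) \<open>0 \<le> K * L\<close> by (intro mult_left_mono) simp_all
  finally show "proj_norm (F t) \<le> K * L * proj_norm t + e" using d by (simp add: algebra_simps)
qed

lemma proj_norm_scaleC: "proj_norm (c *\<^sub>C t) = cmod c * proj_norm t"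
proof -
  have le: "proj_norm (c *\<^sub>C t) \<le> cmod c * proj_norm t" for c and t :: "('a, 'b) alg_tensor"
    using proj_norm_map_le[of "scaleC c" "scaleC c" id "cmod c" 1 t]
    by (simp add: scaleC_alg_tensor.abs_eq norm_scaleC)
  show ?thesis
  proof (cases "c = 0")
    case False
    have "proj_norm t = proj_norm (inverse c *\<^sub>C c *\<^sub>C t)"
      using False by (simp add: scaleC_scaleC scaleC_one)
    also have "\<dots> \<le> cmod (inverse c) * proj_norm (c *\<^sub>C t)" by (rule le)
    finally have "cmod c * proj_norm t \<le> proj_norm (c *\<^sub>C t)"
      using False by (simp add: norm_inverse pos_le_divide_eq[symmetric] divide_inverse mult.commute)
    with le[of c t] show ?thesis by simp
  qed simp
qed

lemma proj_norm_uminus [simp]: "proj_norm (- t) = proj_norm t"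
  using proj_norm_scaleC[of "-1" t] by (simp add: scaleC_minus_one)

lemma proj_norm_minus_commute: "proj_norm (t - u) = proj_norm (u - t)"
  using proj_norm_uminus[of "t - u"] by simp

lemma proj_norm_triangle3: "proj_norm (t - v) \<le> proj_norm (t - u) + proj_norm (u - v)"
  using proj_norm_triangle[of "t - u" "u - v"] by simp

lemma proj_norm_diff_le: "\<bar>proj_norm t - proj_norm u\<bar> \<le> proj_norm (t - u)"
  using proj_norm_triangle[of "t - u" u] proj_norm_triangle[of "u - t" t]
    proj_norm_minus_commute[of t u] by simp

text \<open>The completion: Cauchy sequences modulo null sequences.\<close>

definition proj_Cauchy ::
  "(nat \<Rightarrow> ('a::complex_normed_vector, 'b::complex_normed_vector) alg_tensor) \<Rightarrow> bool" where
  "proj_Cauchy u \<longleftrightarrow> (\<forall>e>0. \<exists>N. \<forall>m\<ge>N. \<forall>n\<ge>N. proj_norm (u m - u n) < e)"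

definition proj_equiv ::
  "(nat \<Rightarrow> ('a::complex_normed_vector, 'b::complex_normed_vector) alg_tensor) \<Rightarrow>
   (nat \<Rightarrow> ('a, 'b) alg_tensor) \<Rightarrow> bool" where
  "proj_equiv u v \<longleftrightarrow> proj_Cauchy u \<and> proj_Cauchy v \<and> (\<lambda>n. proj_norm (u n - v n)) \<longlonglongrightarrow> 0"

lemma proj_Cauchy_const [simp]: "proj_Cauchy (\<lambda>_. t)"
  by (auto simp: proj_Cauchy_def)

lemma proj_Cauchy_dominated:
  assumes "proj_Cauchy u" "\<And>m n. proj_norm (v m - v n) \<le> K * proj_norm (u m - u n)"
  shows "proj_Cauchy v"
  unfolding proj_Cauchy_def
proof (intro allI impI)
  fix e :: real assume "e > 0"
  then have "e / (\<bar>K\<bar> + 1) > 0" by (simp add: add_nonneg_pos)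
  then obtain N where N: "\<And>m n. m \<ge> N \<Longrightarrow> n \<ge> N \<Longrightarrow> proj_norm (u m - u n) < e / (\<bar>K\<bar> + 1)"
    using assms(1) unfolding proj_Cauchy_def by meson
  have "proj_norm (v m - v n) < e" if "m \<ge> N" "n \<ge> N" for m n
  proof -
    have "proj_norm (v m - v n) \<le> K * proj_norm (u m - u n)" by (rule assms)
    also have "\<dots> \<le> (\<bar>K\<bar> + 1) * proj_norm (u m - u n)"
      by (intro mult_right_mono) (auto simp: proj_norm_nonneg)
    also have "\<dots> < e"
      using N[OF that] by (simp add: pos_less_divide_eq add_nonneg_pos mult.commute)
    finally show ?thesis .
  qed
  then show "\<exists>N. \<forall>m\<ge>N. \<forall>n\<ge>N. proj_norm (v m - v n) < e" by blast
qed

lemma proj_Cauchy_add: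
  assumes "proj_Cauchy u" "proj_Cauchy v"
  shows "proj_Cauchy (\<lambda>n. u n + v n)"
  unfolding proj_Cauchy_def
proof (intro allI impI)
  fix e :: real assume "e > 0"
  then have "e / 2 > 0" by simp
  obtain M where M: "\<And>m n. m \<ge> M \<Longrightarrow> n \<ge> M \<Longrightarrow> proj_norm (u m - u n) < e / 2"
    using assms(1) \<open>e / 2 > 0\<close> unfolding proj_Cauchy_def by meson
  obtain N where N: "\<And>m n. m \<ge> N \<Longrightarrow> n \<ge> N \<Longrightarrow> proj_norm (v m - v n) < e / 2"
    using assms(2) \<open>e / 2 > 0\<close> unfolding proj_Cauchy_def by meson
  have "proj_norm ((u m + v m) - (u n + v n)) < e" if "m \<ge> max M N" "n \<ge> max M N" for m n
    using M[of m n] N[of m n] that proj_norm_triangle[of "u m - u n" "v m - v n"]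
    by (simp add: algebra_simps)
  then show "\<exists>N. \<forall>m\<ge>N. \<forall>n\<ge>N. proj_norm ((u m + v m) - (u n + v n)) < e" by blast
qed

lemma proj_equiv_tendsto_dominated:
  assumes "(\<lambda>n. proj_norm (u n)) \<longlonglongrightarrow> 0" "\<And>n. proj_norm (v n) \<le> K * proj_norm (u n)"
  shows "(\<lambda>n. proj_norm (v n)) \<longlonglongrightarrow> 0"
  by (rule tendsto_sandwich[OF _ _ tendsto_const tendsto_mult_right_zero[OF assms(1), of K]])
    (auto simp: assms proj_norm_nonneg)

lemma proj_null_add:
  assumes "(\<lambda>n. proj_norm (u n)) \<longlonglongrightarrow> 0" "(\<lambda>n. proj_norm (v n)) \<longlonglongrightarrow> 0"
  shows "(\<lambda>n. proj_norm (u n + v n)) \<longlonglongrightarrow> 0"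
  by (rule tendsto_sandwich[OF _ _ tendsto_const tendsto_add_zero[OF assms]])
    (auto simp: proj_norm_nonneg proj_norm_triangle)

lemma part_equivp_proj_equiv: "part_equivp proj_equiv"
proof (rule part_equivpI)
  show "\<exists>u. proj_equiv u u" by (rule exI[of _ "\<lambda>_. 0"]) (simp add: proj_equiv_def)
  show "symp proj_equiv"
    by (auto simp: symp_def proj_equiv_def proj_norm_minus_commute)
  show "transp proj_equiv"
  proof (rule transpI)
    fix u v w assume "proj_equiv u v" "proj_equiv v w"
    then show "proj_equiv u w"
      using proj_null_add[of "\<lambda>n. u n - v n" "\<lambda>n. v n - w n"] by (simp add: proj_equiv_def)
  qed
qed

text \<open>The bimodule actions and the product map on elementary tensors.\<close>

lift_definition alg_lmult :: "'a::complex_normed_algebra \<Rightarrow> ('a, 'a) alg_tensor \<Rightarrow> ('a, 'a) alg_tensor" is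
  "\<lambda>a. image_mset (\<lambda>(b, c). (a * b, c))"
proof -
  fix a :: 'a and M N :: "('a \<times> 'a) multiset"
  assume "tensor_cong M N"
  from tensor_cong_map[OF this, of "\<lambda>b. a * b" id]
  show "tensor_cong (image_mset (\<lambda>(b, c). (a * b, c)) M) (image_mset (\<lambda>(b, c). (a * b, c)) N)"
    by (simp add: map_prod_def distrib_left mult_scaleC_right)
qed

lift_definition alg_rmult :: "('a, 'a) alg_tensor \<Rightarrow> 'a::complex_normed_algebra \<Rightarrow> ('a, 'a) alg_tensor" is
  "\<lambda>M a. image_mset (\<lambda>(b, c). (b, c * a)) M"
proof -
  fix a :: 'a and M N :: "('a \<times> 'a) multiset"
  assume "tensor_cong M N"
  from tensor_cong_map[OF this, of id "\<lambda>c. c * a"]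
  show "tensor_cong (image_mset (\<lambda>(b, c). (b, c * a)) M) (image_mset (\<lambda>(b, c). (b, c * a)) N)"
    by (simp add: map_prod_def distrib_right mult_scaleC_left)
qed

lift_definition alg_mult_map :: "('a::complex_normed_algebra, 'a) alg_tensor \<Rightarrow> 'a" is
  "\<lambda>M. \<Sum>(b, c)\<in>#M. b * c"
proof -
  fix M N :: "('a \<times> 'a) multiset"
  assume "tensor_cong M N"
  then show "(\<Sum>(b, c)\<in>#M. b * c) = (\<Sum>(b, c)\<in>#N. b * c)"
    by induction (auto simp: distrib_left distrib_right mult_scaleC_left mult_scaleC_right)
qed

lemma alg_lmult_add: "alg_lmult a (t + u) = alg_lmult a t + alg_lmult a u"
  by transfer (simp add: tensor_refl)

lemma alg_lmult_scaleC: "alg_lmult a (c *\<^sub>C t) = c *\<^sub>C alg_lmult a t"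
  by transfer
    (simp add: multiset.map_comp o_def case_prod_unfold mult_scaleC_right tensor_refl)

lemma alg_rmult_add: "alg_rmult (t + u) a = alg_rmult t a + alg_rmult u a"
  by transfer (simp add: tensor_refl)

lemma alg_rmult_scaleC: "alg_rmult (c *\<^sub>C t) a = c *\<^sub>C alg_rmult t a"
  by transfer
    (simp add: multiset.map_comp o_def case_prod_unfold tensor_refl)

lemma alg_mult_map_add: "alg_mult_map (t + u) = alg_mult_map t + alg_mult_map u"
  by transfer simp

lemma alg_mult_map_scaleC: "alg_mult_map (c *\<^sub>C t) = c *\<^sub>C alg_mult_map t"
proof transfer
  fix c and M :: "('a \<times> 'a) multiset"
  show "(\<Sum>(b, d)\<in># image_mset (map_prod (scaleC c) id) M. b * d) = c *\<^sub>C (\<Sum>(b, d)\<in>#M. b * d)"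
    by (induction M) (auto simp: scaleC_add_right mult_scaleC_left)
qed

lemma alg_lmult_diff: "alg_lmult a (t - u) = alg_lmult a t - alg_lmult a u"
  using alg_lmult_add[of a "t - u" u] by simp

lemma alg_rmult_diff: "alg_rmult (t - u) a = alg_rmult t a - alg_rmult u a"
  using alg_rmult_add[of "t - u" u a] by simp

lemma alg_mult_map_diff: "alg_mult_map (t - u) = alg_mult_map t - alg_mult_map u"
  using alg_mult_map_add[of "t - u" u] by simp

lemma proj_norm_alg_lmult: "proj_norm (alg_lmult a t) \<le> norm a * proj_norm t"
  using proj_norm_map_le[of "alg_lmult a" "\<lambda>b. a * b" id "norm a" 1 t]
  by (simp add: alg_lmult.abs_eq norm_mult_ineq map_prod_def)

lemma proj_norm_alg_rmult: "proj_norm (alg_rmult t a) \<le> norm a * proj_norm t"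
  using proj_norm_map_le[of "\<lambda>t. alg_rmult t a" id "\<lambda>c. c * a" 1 "norm a" t]
  by (simp add: alg_rmult.abs_eq norm_mult_ineq map_prod_def mult.commute[of "norm a"])

lemma norm_alg_mult_map: "norm (alg_mult_map t) \<le> proj_norm t"
proof (rule proj_norm_greatest)
  fix M assume M: "abs_alg_tensor M = t"
  have "norm (\<Sum>(b, c)\<in>#M. b * c) \<le> (\<Sum>(b, c)\<in>#M. norm b * norm c)"
    by (induction M) (auto intro: norm_triangle_le add_mono norm_mult_ineq)
  then show "norm (alg_mult_map t) \<le> (\<Sum>(b, c)\<in>#M. norm b * norm c)"
    by (simp add: M[symmetric] alg_mult_map.abs_eq)
qed

lifting_forget alg_tensor.lifting

quotient_type (overloaded) ('a, 'b) proj_tensor =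
  "nat \<Rightarrow> ('a::complex_normed_vector, 'b::complex_normed_vector) alg_tensor" / partial: proj_equiv
  by (rule part_equivp_proj_equiv)

lemma proj_Cauchy_norm_convergent:
  assumes "proj_Cauchy u"
  shows "(\<lambda>n. proj_norm (u n)) \<longlonglongrightarrow> lim (\<lambda>n. proj_norm (u n))"
proof -
  have "Cauchy (\<lambda>n. proj_norm (u n))"
    unfolding Cauchy_def dist_real_def
    using assms proj_norm_diff_le unfolding proj_Cauchy_def by (meson order_le_less_trans)
  then show ?thesis by (simp add: Cauchy_convergent_iff convergent_LIMSEQ_iff)
qed

lemma proj_equiv_norm_lim:
  assumes "proj_equiv u v"
  shows "lim (\<lambda>n. proj_norm (u n)) = lim (\<lambda>n. proj_norm (v n))"
proof -
  have uv: "proj_Cauchy u" "proj_Cauchy v" and 0: "(\<lambda>n. proj_norm (u n - v n)) \<longlonglongrightarrow> 0"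
    using assms by (auto simp: proj_equiv_def)
  have "(\<lambda>n. proj_norm (u n) - proj_norm (v n)) \<longlonglongrightarrow> 0"
    by (rule Lim_null_comparison[OF _ 0]) (simp add: proj_norm_diff_le)
  moreover have "(\<lambda>n. proj_norm (u n) - proj_norm (v n)) \<longlonglongrightarrow>
      lim (\<lambda>n. proj_norm (u n)) - lim (\<lambda>n. proj_norm (v n))"
    by (intro tendsto_diff proj_Cauchy_norm_convergent uv)
  ultimately show ?thesis using LIMSEQ_unique[of _ 0] by (metis right_minus_eq)
qed

lemma proj_equiv_scaleC: "proj_equiv u v \<Longrightarrow> proj_equiv (\<lambda>n. c *\<^sub>C u n) (\<lambda>n. c *\<^sub>C v n)"
  unfolding proj_equiv_def
  by (auto intro: proj_Cauchy_dominated[where K = "cmod c"] tendsto_mult_right_zero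
      simp: proj_norm_scaleC simp flip: scaleC_diff_right)

lemma proj_equiv_add:
  "proj_equiv u u' \<Longrightarrow> proj_equiv v v' \<Longrightarrow> proj_equiv (\<lambda>n. u n + v n) (\<lambda>n. u' n + v' n)"
  unfolding proj_equiv_def
  using proj_null_add[of "\<lambda>n. u n - u' n" "\<lambda>n. v n - v' n"]
  by (auto intro: proj_Cauchy_add simp: algebra_simps)

instantiation proj_tensor :: (complex_normed_vector, complex_normed_vector) complex_normed_vector
begin

lift_definition zero_proj_tensor :: "('a, 'b) proj_tensor" is "\<lambda>_. 0"
  by (simp add: proj_equiv_def)

lift_definition plus_proj_tensor ::
  "('a, 'b) proj_tensor \<Rightarrow> ('a, 'b) proj_tensor \<Rightarrow> ('a, 'b) proj_tensor" is "\<lambda>u v n. u n + v n"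
  by (rule proj_equiv_add)

lift_definition scaleC_proj_tensor ::
  "complex \<Rightarrow> ('a, 'b) proj_tensor \<Rightarrow> ('a, 'b) proj_tensor" is "\<lambda>c u n. c *\<^sub>C u n"
  by (rule proj_equiv_scaleC)

lift_definition uminus_proj_tensor :: "('a, 'b) proj_tensor \<Rightarrow> ('a, 'b) proj_tensor" is
  "\<lambda>u n. - u n"
  using proj_equiv_scaleC[of _ _ "-1"] by (simp add: scaleC_minus_one)

definition minus_proj_tensor ::
  "('a, 'b) proj_tensor \<Rightarrow> ('a, 'b) proj_tensor \<Rightarrow> ('a, 'b) proj_tensor" where
  "minus_proj_tensor x y = x + (- y)"

definition scaleR_proj_tensor :: "real \<Rightarrow> ('a, 'b) proj_tensor \<Rightarrow> ('a, 'b) proj_tensor" where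
  "scaleR_proj_tensor r x = complex_of_real r *\<^sub>C x"

lift_definition norm_proj_tensor :: "('a, 'b) proj_tensor \<Rightarrow> real" is
  "\<lambda>u. lim (\<lambda>n. proj_norm (u n))"
  by (rule proj_equiv_norm_lim)

definition sgn_proj_tensor :: "('a, 'b) proj_tensor \<Rightarrow> ('a, 'b) proj_tensor" where
  "sgn_proj_tensor x = scaleR (inverse (norm x)) x"
definition dist_proj_tensor :: "('a, 'b) proj_tensor \<Rightarrow> ('a, 'b) proj_tensor \<Rightarrow> real" where
  "dist_proj_tensor x y = norm (x - y)"
definition uniformity_proj_tensor :: "(('a, 'b) proj_tensor \<times> ('a, 'b) proj_tensor) filter" where
  "uniformity_proj_tensor = (INF e\<in>{0 <..}. principal {(x, y). dist x y < e})"
definition open_proj_tensor :: "('a, 'b) proj_tensor set \<Rightarrow> bool" where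
  "open_proj_tensor S = (\<forall>x\<in>S. \<forall>\<^sub>F (x', y) in uniformity. x' = x \<longrightarrow> y \<in> S)"

instance
proof
  fix x y z :: "('a, 'b) proj_tensor" and c d :: complex and r s :: real
  show "x + y + z = x + (y + z)"
    by transfer (auto simp: add.assoc intro: proj_equiv_add)
  show "x + y = y + x"
  proof transfer
    fix u v :: "nat \<Rightarrow> ('a, 'b) alg_tensor"
    assume "proj_equiv u u" "proj_equiv v v"
    then have "proj_equiv (\<lambda>n. u n + v n) (\<lambda>n. u n + v n)" by (rule proj_equiv_add)
    then show "proj_equiv (\<lambda>n. u n + v n) (\<lambda>n. v n + u n)" by (subst (asm) (2) add.commute)
  qed
  show "0 + x = x" by transfer simp
  show "- x + x = 0" by transfer (simp add: proj_equiv_def)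
  show "x - y = x + - y" by (rule minus_proj_tensor_def)
  show C1: "c *\<^sub>C (x + y) = c *\<^sub>C x + c *\<^sub>C y" for c and x y :: "('a, 'b) proj_tensor"
    by transfer (auto simp: scaleC_add_right intro!: proj_equiv_scaleC proj_equiv_add)
  show C2: "(c + d) *\<^sub>C x = c *\<^sub>C x + d *\<^sub>C x" for c d and x :: "('a, 'b) proj_tensor"
    by transfer (auto simp: scaleC_add_left intro!: proj_equiv_scaleC proj_equiv_add)
  show C3: "c *\<^sub>C d *\<^sub>C x = (c * d) *\<^sub>C x" for c d and x :: "('a, 'b) proj_tensor"
    by transfer (auto simp: scaleC_scaleC intro!: proj_equiv_scaleC)
  show C4: "1 *\<^sub>C x = x" for x :: "('a, 'b) proj_tensor"
    by transfer (auto simp: scaleC_one)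
  show R: "r *\<^sub>R x = complex_of_real r *\<^sub>C x" for r and x :: "('a, 'b) proj_tensor"
    by (rule scaleR_proj_tensor_def)
  show "r *\<^sub>R (x + y) = r *\<^sub>R x + r *\<^sub>R y" "(r + s) *\<^sub>R x = r *\<^sub>R x + s *\<^sub>R x"
    "r *\<^sub>R s *\<^sub>R x = (r * s) *\<^sub>R x" "1 *\<^sub>R x = x"
    by (simp_all add: R C1 C2 C3 C4)
  show NC: "norm (c *\<^sub>C x) = cmod c * norm x" for c and x :: "('a, 'b) proj_tensor"
  proof transfer
    fix c :: complex and u :: "nat \<Rightarrow> ('a, 'b) alg_tensor"
    assume "proj_equiv u u"
    then have "(\<lambda>n. cmod c * proj_norm (u n)) \<longlonglongrightarrow> cmod c * lim (\<lambda>n. proj_norm (u n))"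
      by (intro tendsto_mult tendsto_const proj_Cauchy_norm_convergent) (simp add: proj_equiv_def)
    then show "lim (\<lambda>n. proj_norm (c *\<^sub>C u n)) = cmod c * lim (\<lambda>n. proj_norm (u n))"
      unfolding proj_norm_scaleC by (rule limI)
  qed
  show "norm (r *\<^sub>R x) = \<bar>r\<bar> * norm x" by (simp add: R NC)
  show "sgn x = scaleR (inverse (norm x)) x" "dist x y = norm (x - y)"
    "(uniformity :: (('a, 'b) proj_tensor \<times> ('a, 'b) proj_tensor) filter) =
      (INF e\<in>{0 <..}. principal {(x, y). dist x y < e})"
    by (auto simp: sgn_proj_tensor_def dist_proj_tensor_def uniformity_proj_tensor_def)
  show "open U \<longleftrightarrow> (\<forall>x\<in>U. \<forall>\<^sub>F (x', y) in uniformity. x' = x \<longrightarrow> y \<in> U)"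
    for U :: "('a, 'b) proj_tensor set"
    by (simp add: open_proj_tensor_def)
  show "norm x = 0 \<longleftrightarrow> x = 0"
  proof transfer
    fix u :: "nat \<Rightarrow> ('a, 'b) alg_tensor"
    assume "proj_equiv u u"
    then have u: "proj_Cauchy u" by (simp add: proj_equiv_def)
    show "lim (\<lambda>n. proj_norm (u n)) = 0 \<longleftrightarrow> proj_equiv u (\<lambda>_. 0)"
    proof
      assume "lim (\<lambda>n. proj_norm (u n)) = 0"
      then show "proj_equiv u (\<lambda>_. 0)"
        using u proj_Cauchy_norm_convergent[OF u] by (simp add: proj_equiv_def)
    next
      assume "proj_equiv u (\<lambda>_. 0)"
      then have "(\<lambda>n. proj_norm (u n)) \<longlonglongrightarrow> 0" by (simp add: proj_equiv_def)
      then show "lim (\<lambda>n. proj_norm (u n)) = 0" by (rule limI)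
    qed
  qed
  show "norm (x + y) \<le> norm x + norm y"
  proof transfer
    fix u v :: "nat \<Rightarrow> ('a, 'b) alg_tensor"
    assume "proj_equiv u u" "proj_equiv v v"
    then have uv: "proj_Cauchy u" "proj_Cauchy v" by (auto simp: proj_equiv_def)
    show "lim (\<lambda>n. proj_norm (u n + v n)) \<le> lim (\<lambda>n. proj_norm (u n)) + lim (\<lambda>n. proj_norm (v n))"
      by (rule LIMSEQ_le[OF proj_Cauchy_norm_convergent[OF proj_Cauchy_add[OF uv]]
            tendsto_add[OF proj_Cauchy_norm_convergent[OF uv(1)] proj_Cauchy_norm_convergent[OF uv(2)]]])
        (auto simp: proj_norm_triangle)
  qed
qed

end

lift_definition of_alg_tensor ::
  "('a::complex_normed_vector, 'b::complex_normed_vector) alg_tensor \<Rightarrow> ('a, 'b) proj_tensor" is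
  "\<lambda>t _. t"
  by (simp add: proj_equiv_def)

lemma of_alg_tensor_simps:
  "of_alg_tensor 0 = 0"
  "of_alg_tensor (t + u) = of_alg_tensor t + of_alg_tensor u"
  "of_alg_tensor (t - u) = of_alg_tensor t - of_alg_tensor u"
  "of_alg_tensor (c *\<^sub>C t) = c *\<^sub>C of_alg_tensor t"
  "norm (of_alg_tensor t) = proj_norm t"
proof -
  show "of_alg_tensor (t - u) = of_alg_tensor t - of_alg_tensor u"
    unfolding minus_proj_tensor_def by transfer (simp add: proj_equiv_def)
qed (transfer; simp add: proj_equiv_def)+

lemma of_alg_tensor_tendsto:
  assumes "proj_Cauchy u"
  shows "(\<lambda>n. of_alg_tensor (u n)) \<longlonglongrightarrow> abs_proj_tensor u"
proof (rule metric_LIMSEQ_I)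
  fix e :: real assume "e > 0"
  then obtain N where N: "\<And>m n. m \<ge> N \<Longrightarrow> n \<ge> N \<Longrightarrow> proj_norm (u m - u n) < e / 2"
    using assms unfolding proj_Cauchy_def by (meson half_gt_zero)
  have "dist (of_alg_tensor (u n)) (abs_proj_tensor u) < e" if n: "n \<ge> N" for n
  proof -
    have eq: "of_alg_tensor (u n) - abs_proj_tensor u = abs_proj_tensor (\<lambda>m. u n - u m)"
      using assms proj_equiv_scaleC[of u u "-1"]
      by (simp add: minus_proj_tensor_def of_alg_tensor.abs_eq uminus_proj_tensor.abs_eq
          plus_proj_tensor.abs_eq proj_equiv_def scaleC_minus_one)
    have C: "proj_Cauchy (\<lambda>m. u n - u m)"
      by (rule proj_Cauchy_dominated[OF assms, where K = 1])
        (simp add: proj_norm_minus_commute)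
    have "norm (of_alg_tensor (u n) - abs_proj_tensor u) = lim (\<lambda>m. proj_norm (u n - u m))"
      using C by (simp add: eq norm_proj_tensor.abs_eq proj_equiv_def)
    also have "\<dots> \<le> e / 2"
      by (rule LIMSEQ_le_const2[OF proj_Cauchy_norm_convergent[OF C]])
        (use N n in \<open>auto intro!: exI[of _ N] less_imp_le\<close>)
    finally show ?thesis using \<open>e > 0\<close> by (simp add: dist_norm)
  qed
  then show "\<exists>no. \<forall>n\<ge>no. dist (of_alg_tensor (u n)) (abs_proj_tensor u) < e" by blast
qed

lemma proj_tensor_cases:
  obtains u where "proj_Cauchy u" "x = abs_proj_tensor u"
proof -
  have "proj_equiv (rep_proj_tensor x) (rep_proj_tensor x)"
    by (rule Quotient_rep_reflp[OF Quotient_proj_tensor])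
  moreover have "x = abs_proj_tensor (rep_proj_tensor x)"
    by (simp add: Quotient_abs_rep[OF Quotient_proj_tensor])
  ultimately show ?thesis using that by (simp add: proj_equiv_def)
qed

lemma of_alg_tensor_dense:
  assumes "e > 0"
  shows "\<exists>t. dist x (of_alg_tensor t) < e"
proof -
  obtain u where "proj_Cauchy u" "x = abs_proj_tensor u" by (rule proj_tensor_cases)
  from metric_LIMSEQ_D[OF of_alg_tensor_tendsto[OF this(1)] assms] this(2)
  show ?thesis by (auto simp: dist_commute)
qed

lemma proj_Cauchy_iff: "proj_Cauchy u \<longleftrightarrow> Cauchy (\<lambda>n. of_alg_tensor (u n))"
  by (simp add: proj_Cauchy_def Cauchy_def dist_norm flip: of_alg_tensor_simps)

instance proj_tensor :: (complex_normed_vector, complex_normed_vector) complex_banach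
proof
  fix X :: "nat \<Rightarrow> ('a, 'b) proj_tensor"
  assume X: "Cauchy X"
  have "\<exists>t. dist (X n) (of_alg_tensor t) < inverse (real (Suc n))" for n
    by (rule of_alg_tensor_dense) simp
  then obtain t where t: "\<And>n. dist (X n) (of_alg_tensor (t n)) < inverse (real (Suc n))" by metis
  have D: "(\<lambda>n. dist (X n) (of_alg_tensor (t n))) \<longlonglongrightarrow> 0"
    by (rule tendsto_sandwich[OF _ _ tendsto_const LIMSEQ_inverse_real_of_nat])
      (use t in \<open>auto intro!: always_eventually less_imp_le simp del: of_nat_Suc\<close>)
  have "(\<lambda>n. X n - of_alg_tensor (t n)) \<longlonglongrightarrow> 0"
    using D by (simp add: dist_norm tendsto_norm_zero_iff)
  from tendsto_minus[OF this] have "(\<lambda>n. of_alg_tensor (t n) - X n) \<longlonglongrightarrow> 0" by simp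
  have "Cauchy (\<lambda>n. of_alg_tensor (t n))"
  proof (rule metric_CauchyI)
    fix e :: real assume "e > 0"
    then have e: "e / 3 > 0" by simp
    obtain N1 where N1: "\<And>m n. m \<ge> N1 \<Longrightarrow> n \<ge> N1 \<Longrightarrow> dist (X m) (X n) < e / 3"
      using metric_CauchyD[OF X e] by blast
    obtain N2 where N2: "\<And>n. n \<ge> N2 \<Longrightarrow> dist (X n) (of_alg_tensor (t n)) < e / 3"
      using order_tendstoD(2)[OF D e] by (auto simp: eventually_sequentially)
    have "dist (of_alg_tensor (t m)) (of_alg_tensor (t n)) < e" if "m \<ge> max N1 N2" "n \<ge> max N1 N2" for m n
    proof -
      have "dist (of_alg_tensor (t m)) (of_alg_tensor (t n)) \<le>
          dist (X m) (of_alg_tensor (t m)) + dist (X m) (X n) + dist (X n) (of_alg_tensor (t n))"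
        by metric
      then show ?thesis using N1[of m n] N2[of m] N2[of n] that by simp
    qed
    then show "\<exists>M. \<forall>m\<ge>M. \<forall>n\<ge>M. dist (of_alg_tensor (t m)) (of_alg_tensor (t n)) < e" by blast
  qed
  then have "proj_Cauchy t" by (simp add: proj_Cauchy_iff)
  from tendsto_diff[OF of_alg_tensor_tendsto[OF this] \<open>(\<lambda>n. of_alg_tensor (t n) - X n) \<longlonglongrightarrow> 0\<close>]
  show "convergent X" by (auto simp: convergent_def)
qed

definition tensor ::
  "'a::complex_normed_vector \<Rightarrow> 'b::complex_normed_vector \<Rightarrow> ('a, 'b) proj_tensor"  (infixl \<open>\<otimes>\<^sub>p\<close> 70)
  where "b \<otimes>\<^sub>p c = of_alg_tensor (abs_alg_tensor {#(b, c)#})"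

lemma proj_Cauchy_alg_lmult: "proj_Cauchy u \<Longrightarrow> proj_Cauchy (\<lambda>n. alg_lmult a (u n))"
  by (rule proj_Cauchy_dominated[where K = "norm a"])
    (auto simp: proj_norm_alg_lmult simp flip: alg_lmult_diff)

lemma proj_Cauchy_alg_rmult: "proj_Cauchy u \<Longrightarrow> proj_Cauchy (\<lambda>n. alg_rmult (u n) a)"
  by (rule proj_Cauchy_dominated[where K = "norm a"])
    (auto simp: proj_norm_alg_rmult simp flip: alg_rmult_diff)

lemma proj_Cauchy_scaleC: "proj_Cauchy u \<Longrightarrow> proj_Cauchy (\<lambda>n. c *\<^sub>C u n)"
  by (rule proj_Cauchy_dominated[where K = "cmod c"])
    (auto simp: proj_norm_scaleC simp flip: scaleC_diff_right)

lift_definition tensor_lmult ::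
  "'a::complex_banach_algebra \<Rightarrow> ('a, 'a) proj_tensor \<Rightarrow> ('a, 'a) proj_tensor" is
  "\<lambda>a u n. alg_lmult a (u n)"
  unfolding proj_equiv_def
  by (auto intro: proj_Cauchy_alg_lmult proj_equiv_tendsto_dominated proj_norm_alg_lmult
      simp flip: alg_lmult_diff)

lift_definition tensor_rmult ::
  "('a, 'a) proj_tensor \<Rightarrow> 'a::complex_banach_algebra \<Rightarrow> ('a, 'a) proj_tensor" is
  "\<lambda>u a n. alg_rmult (u n) a"
  unfolding proj_equiv_def
  by (auto intro: proj_Cauchy_alg_rmult proj_equiv_tendsto_dominated proj_norm_alg_rmult
      simp flip: alg_rmult_diff)

lemma alg_mult_map_convergent:
  fixes u :: "nat \<Rightarrow> ('a::complex_banach_algebra, 'a) alg_tensor"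
  assumes "proj_Cauchy u"
  shows "(\<lambda>n. alg_mult_map (u n)) \<longlonglongrightarrow> lim (\<lambda>n. alg_mult_map (u n))"
proof -
  have "Cauchy (\<lambda>n. alg_mult_map (u n))"
    unfolding Cauchy_def dist_norm
    using assms norm_alg_mult_map order_le_less_trans
    unfolding proj_Cauchy_def alg_mult_map_diff[symmetric] by meson
  then show ?thesis by (simp add: Cauchy_convergent_iff convergent_LIMSEQ_iff)
qed

lift_definition tensor_mult_map :: "('a::complex_banach_algebra, 'a) proj_tensor \<Rightarrow> 'a" is
  "\<lambda>u. lim (\<lambda>n. alg_mult_map (u n))"
proof -
  fix u v :: "nat \<Rightarrow> ('a, 'a) alg_tensor"
  assume "proj_equiv u v"
  then have uv: "proj_Cauchy u" "proj_Cauchy v" and 0: "(\<lambda>n. proj_norm (u n - v n)) \<longlonglongrightarrow> 0"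
    by (auto simp: proj_equiv_def)
  have "(\<lambda>n. alg_mult_map (u n) - alg_mult_map (v n)) \<longlonglongrightarrow> 0"
    by (rule Lim_null_comparison[OF _ 0]) (simp add: norm_alg_mult_map flip: alg_mult_map_diff)
  moreover have "(\<lambda>n. alg_mult_map (u n) - alg_mult_map (v n)) \<longlonglongrightarrow>
      lim (\<lambda>n. alg_mult_map (u n)) - lim (\<lambda>n. alg_mult_map (v n))"
    by (intro tendsto_diff alg_mult_map_convergent uv)
  ultimately show "lim (\<lambda>n. alg_mult_map (u n)) = lim (\<lambda>n. alg_mult_map (v n))"
    using LIMSEQ_unique[of _ 0] by (metis right_minus_eq)
qed

lemma tensor_lmult_tensor [simp]: "tensor_lmult a (b \<otimes>\<^sub>p c) = (a * b) \<otimes>\<^sub>p c"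
  by (simp add: tensor_def of_alg_tensor.abs_eq tensor_lmult.abs_eq proj_equiv_def alg_lmult.abs_eq)

lemma tensor_rmult_tensor [simp]: "tensor_rmult (b \<otimes>\<^sub>p c) a = b \<otimes>\<^sub>p (c * a)"
  by (simp add: tensor_def of_alg_tensor.abs_eq tensor_rmult.abs_eq proj_equiv_def alg_rmult.abs_eq)

lemma tensor_mult_map_tensor [simp]: "tensor_mult_map (b \<otimes>\<^sub>p c) = b * c"
  by (simp add: tensor_def of_alg_tensor.abs_eq tensor_mult_map.abs_eq proj_equiv_def
      alg_mult_map.abs_eq)

lemma bounded_clinear_tensor_lmult: "bounded_clinear (tensor_lmult a)"
proof (rule bounded_clinearI[where K = "norm a"])
  show "tensor_lmult a (x + y) = tensor_lmult a x + tensor_lmult a y" for x y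
    by transfer (auto simp: alg_lmult_add proj_equiv_def intro: proj_Cauchy_add proj_Cauchy_alg_lmult)
  show "tensor_lmult a (c *\<^sub>C x) = c *\<^sub>C tensor_lmult a x" for c x
    by transfer (auto simp: alg_lmult_scaleC proj_equiv_def intro: proj_Cauchy_scaleC proj_Cauchy_alg_lmult)
  show "norm (tensor_lmult a x) \<le> norm x * norm a" for x
  proof transfer
    fix u :: "nat \<Rightarrow> ('a, 'a) alg_tensor" and a :: 'a
    assume "proj_equiv u u"
    then have u: "proj_Cauchy u" by (simp add: proj_equiv_def)
    show "lim (\<lambda>n. proj_norm (alg_lmult a (u n))) \<le> lim (\<lambda>n. proj_norm (u n)) * norm a"
      by (rule LIMSEQ_le[OF proj_Cauchy_norm_convergent[OF proj_Cauchy_alg_lmult[OF u]]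
            tendsto_mult[OF proj_Cauchy_norm_convergent[OF u] tendsto_const]])
        (auto simp: proj_norm_alg_lmult mult.commute[of _ "norm a"])
  qed
qed

lemma bounded_clinear_tensor_rmult: "bounded_clinear (\<lambda>x. tensor_rmult x a)"
proof (rule bounded_clinearI[where K = "norm a"])
  show "tensor_rmult (x + y) a = tensor_rmult x a + tensor_rmult y a" for x y
    by transfer (auto simp: alg_rmult_add proj_equiv_def intro: proj_Cauchy_add proj_Cauchy_alg_rmult)
  show "tensor_rmult (c *\<^sub>C x) a = c *\<^sub>C tensor_rmult x a" for c x
    by transfer (auto simp: alg_rmult_scaleC proj_equiv_def intro: proj_Cauchy_scaleC proj_Cauchy_alg_rmult)
  show "norm (tensor_rmult x a) \<le> norm x * norm a" for x
  proof transfer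
    fix u :: "nat \<Rightarrow> ('a, 'a) alg_tensor" and a :: 'a
    assume "proj_equiv u u"
    then have u: "proj_Cauchy u" by (simp add: proj_equiv_def)
    show "lim (\<lambda>n. proj_norm (alg_rmult (u n) a)) \<le> lim (\<lambda>n. proj_norm (u n)) * norm a"
      by (rule LIMSEQ_le[OF proj_Cauchy_norm_convergent[OF proj_Cauchy_alg_rmult[OF u]]
            tendsto_mult[OF proj_Cauchy_norm_convergent[OF u] tendsto_const]])
        (auto simp: proj_norm_alg_rmult mult.commute[of _ "norm a"])
  qed
qed

lemma bounded_clinear_tensor_mult_map: "bounded_clinear tensor_mult_map"
proof (rule bounded_clinearI[where K = 1])
  show "tensor_mult_map (x + y) = tensor_mult_map x + tensor_mult_map y" for x y :: "('a, 'a) proj_tensor"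
  proof transfer
    fix u v :: "nat \<Rightarrow> ('a, 'a) alg_tensor"
    assume "proj_equiv u u" "proj_equiv v v"
    then show "lim (\<lambda>n. alg_mult_map (u n + v n)) = lim (\<lambda>n. alg_mult_map (u n)) + lim (\<lambda>n. alg_mult_map (v n))"
      by (intro limI) (auto simp: alg_mult_map_add proj_equiv_def
          intro!: tendsto_add alg_mult_map_convergent)
  qed
  show "tensor_mult_map (c *\<^sub>C x) = c *\<^sub>C tensor_mult_map x" for c and x :: "('a, 'a) proj_tensor"
  proof transfer
    fix c and u :: "nat \<Rightarrow> ('a, 'a) alg_tensor"
    assume "proj_equiv u u"
    then have u: "(\<lambda>n. alg_mult_map (u n)) \<longlonglongrightarrow> lim (\<lambda>n. alg_mult_map (u n))"
      by (simp add: proj_equiv_def alg_mult_map_convergent)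
    have "bounded_linear (\<lambda>x :: 'a. c *\<^sub>C x)"
      by (rule bounded_linear_intro[of _ "cmod c"])
        (auto simp: scaleC_add_right scaleR_scaleC scaleC_scaleC norm_scaleC mult.commute)
    from bounded_linear.tendsto[OF this u]
    show "lim (\<lambda>n. alg_mult_map (c *\<^sub>C u n)) = c *\<^sub>C lim (\<lambda>n. alg_mult_map (u n))"
      unfolding alg_mult_map_scaleC by (rule limI)
  qed
  show "norm (tensor_mult_map x) \<le> norm x * 1" for x :: "('a, 'a) proj_tensor"
    unfolding mult_1_right
  proof transfer
    fix u :: "nat \<Rightarrow> ('a, 'a) alg_tensor"
    assume "proj_equiv u u"
    then have u: "proj_Cauchy u" by (simp add: proj_equiv_def)
    show "norm (lim (\<lambda>n. alg_mult_map (u n))) \<le> lim (\<lambda>n. proj_norm (u n))"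
      by (rule LIMSEQ_le[OF tendsto_norm[OF alg_mult_map_convergent[OF u]] proj_Cauchy_norm_convergent[OF u]])
        (auto simp: norm_alg_mult_map)
  qed
qed


section \<open>Strong pseudo-amenability\<close>

text \<open>
  Dual bimodules: given a bimodule \<open>X\<close> with left action \<open>l a x = a \<cdot> x\<close> and right action
  \<open>r x a = x \<cdot> a\<close>, the actions on the dual are \<open>(a \<cdot> f)(x) = f(x \<cdot> a)\<close> and
  \<open>(f \<cdot> a)(x) = f(a \<cdot> x)\<close>.
\<close>

definition dual_lmult ::
  "('x::complex_normed_vector \<Rightarrow> 'a \<Rightarrow> 'x) \<Rightarrow> 'a \<Rightarrow> 'x cdual \<Rightarrow> 'x cdual" where
  "dual_lmult r a f = transposed (\<lambda>x. r x a) f"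

definition dual_rmult ::
  "('a \<Rightarrow> 'x::complex_normed_vector \<Rightarrow> 'x) \<Rightarrow> 'x cdual \<Rightarrow> 'a \<Rightarrow> 'x cdual" where
  "dual_rmult l f a = transposed (\<lambda>x. l a x) f"

definition bidual_lmult ::
  "('a \<Rightarrow> 'x::complex_normed_vector \<Rightarrow> 'x) \<Rightarrow> 'a \<Rightarrow> 'x cdual cdual \<Rightarrow> 'x cdual cdual" where
  "bidual_lmult l = dual_lmult (dual_rmult l)"

definition bidual_rmult ::
  "('x::complex_normed_vector \<Rightarrow> 'a \<Rightarrow> 'x) \<Rightarrow> 'x cdual cdual \<Rightarrow> 'a \<Rightarrow> 'x cdual cdual" where
  "bidual_rmult r = dual_rmult (dual_lmult r)"

lemma cdual_apply_dual_mult: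
  "bounded_clinear (\<lambda>x. r x a) \<Longrightarrow> cdual_apply (dual_lmult r a f) x = cdual_apply f (r x a)"
  "bounded_clinear (l a) \<Longrightarrow> cdual_apply (dual_rmult l f a) x = cdual_apply f (l a x)"
  by (simp_all add: dual_lmult_def dual_rmult_def cdual_apply_transposed)

lemma cdual_apply_bidual_mult:
  "bounded_clinear (l a) \<Longrightarrow> cdual_apply (bidual_lmult l a F) f = cdual_apply F (dual_rmult l f a)"
  "bounded_clinear (\<lambda>x. r x a) \<Longrightarrow> cdual_apply (bidual_rmult r F a) f = cdual_apply F (dual_lmult r a f)"
  unfolding bidual_lmult_def bidual_rmult_def
  by (subst cdual_apply_dual_mult;
      simp add: bounded_clinear_transposed dual_lmult_def[abs_def] dual_rmult_def[abs_def])+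

definition bidual_mult_map ::
  "('a::complex_banach_algebra, 'a) proj_tensor cdual cdual \<Rightarrow> 'a cdual cdual" where
  "bidual_mult_map = transposed (transposed tensor_mult_map)"

lemma cdual_apply_bidual_mult_map:
  "cdual_apply (bidual_mult_map m) f = cdual_apply m (transposed tensor_mult_map f)"
  by (simp add: bidual_mult_map_def cdual_apply_transposed bounded_clinear_transposed
      bounded_clinear_tensor_mult_map)

text \<open>A net is a family indexed by a directed set; its limits are those along the filter of tails.\<close>

definition directed_set :: "'d set \<Rightarrow> ('d \<Rightarrow> 'd \<Rightarrow> bool) \<Rightarrow> bool" where
  "directed_set D le \<longleftrightarrow> D \<noteq> {} \<and> reflp_on D le \<and> transp_on D le \<and>
     (\<forall>x\<in>D. \<forall>y\<in>D. \<exists>z\<in>D. le x z \<and> le y z)"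

definition tails :: "'d set \<Rightarrow> ('d \<Rightarrow> 'd \<Rightarrow> bool) \<Rightarrow> 'd filter" where
  "tails D le = (INF d\<in>D. principal {e \<in> D. le d e})"

lemma eventually_tails:
  assumes "directed_set D le"
  shows "eventually P (tails D le) \<longleftrightarrow> (\<exists>d\<in>D. \<forall>e\<in>D. le d e \<longrightarrow> P e)"
  unfolding tails_def
proof (subst eventually_INF_base)
  show "D \<noteq> {}" using assms by (simp add: directed_set_def)
  fix x y assume xy: "x \<in> D" "y \<in> D"
  then obtain z where z: "z \<in> D" "le x z" "le y z" using assms by (auto simp: directed_set_def)
  have "{e \<in> D. le z e} \<subseteq> {e \<in> D. le x e} \<inter> {e \<in> D. le y e}"
    using assms xy z by (auto simp: directed_set_def dest: transp_onD)
  then show "\<exists>z\<in>D. principal {e \<in> D. le z e} \<le> inf (principal {e \<in> D. le x e}) (principal {e \<in> D. le y e})"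
    using z by auto
qed (auto simp: eventually_principal)

definition strong_pseudo_diagonal_net ::
  "'d set \<Rightarrow> ('d \<Rightarrow> 'd \<Rightarrow> bool) \<Rightarrow>
   ('d \<Rightarrow> ('a::complex_banach_algebra, 'a) proj_tensor cdual cdual) \<Rightarrow> bool" where
  "strong_pseudo_diagonal_net D le m \<longleftrightarrow> directed_set D le \<and> (\<forall>a.
     ((\<lambda>\<alpha>. bidual_lmult tensor_lmult a (m \<alpha>) - bidual_rmult tensor_rmult (m \<alpha>) a)
        \<longlongrightarrow> 0) (tails D le) \<and>
     (\<forall>\<alpha>\<in>D. bidual_lmult (*) a (bidual_mult_map (m \<alpha>)) = bidual_rmult (*) (bidual_mult_map (m \<alpha>)) a) \<and>
     ((\<lambda>\<alpha>. bidual_rmult (*) (bidual_mult_map (m \<alpha>)) a) \<longlongrightarrow> bidual_embed a) (tails D le))"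

text \<open>
  HOL cannot quantify over the type of the index set. With \<open>X = (A \<otimes>\<^sub>p A)\<^sup>*\<^sup>*\<close> the type
  \<open>X \<times> X set\<close> used here is large enough for every net in \<open>X\<close>, as shown by the lemma
  \<open>strong_pseudo_amenableI\<close> below.
\<close>

definition strong_pseudo_amenable :: "'a::complex_banach_algebra itself \<Rightarrow> bool" where
  "strong_pseudo_amenable (A :: 'a itself) \<longleftrightarrow>
     (\<exists>(D :: (('a, 'a) proj_tensor cdual cdual \<times> ('a, 'a) proj_tensor cdual cdual set) set) le
        (m :: _ \<Rightarrow> ('a, 'a) proj_tensor cdual cdual). strong_pseudo_diagonal_net D le m)"

lemma strong_pseudo_amenableI:
  fixes m :: "'d \<Rightarrow> ('a::complex_banach_algebra, 'a) proj_tensor cdual cdual"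
  assumes "strong_pseudo_diagonal_net D le m"
  shows "strong_pseudo_amenable TYPE('a)"
proof -
  have D: "directed_set D le" using assms by (simp add: strong_pseudo_diagonal_net_def)
  define tl where "tl d = m ` {e \<in> D. le d e}" for d
  define E where "E = {(x, S). \<exists>d\<in>D. S = tl d \<and> x \<in> S}"
  define ge where "ge p q \<longleftrightarrow> snd q \<subseteq> snd p" 
    for p q :: "('a, 'a) proj_tensor cdual cdual \<times> ('a, 'a) proj_tensor cdual cdual set"
  have tl: "m d \<in> tl d" if "d \<in> D" for d
    using D that by (auto simp: tl_def directed_set_def dest: reflp_onD)
  have mono: "tl e \<subseteq> tl d" if "d \<in> D" "e \<in> D" "le d e" for d e
    using D that by (auto simp: tl_def directed_set_def dest: transp_onD)
  have inE: "(m d, tl d) \<in> E" if "d \<in> D" for d using tl[OF that] that by (auto simp: E_def)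
  have E: "directed_set E ge"
    unfolding directed_set_def
  proof (intro conjI ballI)
    show "E \<noteq> {}" using D inE by (auto simp: directed_set_def)
    show "reflp_on E ge" "transp_on E ge" by (auto simp: reflp_on_def transp_on_def ge_def)
    fix p q assume "p \<in> E" "q \<in> E"
    then obtain d e where de: "d \<in> D" "e \<in> D" "snd p = tl d" "snd q = tl e" by (auto simp: E_def)
    then obtain c where "c \<in> D" "le d c" "le e c" using D unfolding directed_set_def by meson
    then show "\<exists>r\<in>E. ge p r \<and> ge q r"
      using de mono inE by (intro bexI[of _ "(m c, tl c)"]) (auto simp: ge_def)
  qed
  have ev: "eventually (\<lambda>p. P (fst p)) (tails E ge)"
    if P: "eventually (\<lambda>d. P (m d)) (tails D le)" for P
  proof -
    obtain d where "d \<in> D" "\<forall>e\<in>D. le d e \<longrightarrow> P (m e)"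
      using P unfolding eventually_tails[OF D] by blast
    then show ?thesis
      unfolding eventually_tails[OF E]
      by (intro bexI[OF _ inE[of d]]) (auto simp: ge_def E_def tl_def)
  qed
  have lim: "((\<lambda>p. f (fst p)) \<longlongrightarrow> L) (tails E ge)" if "((\<lambda>d. f (m d)) \<longlongrightarrow> L) (tails D le)"
    for f :: "_ \<Rightarrow> 'x::topological_space" and L
    using that by (auto simp: tendsto_def intro: ev)
  have "fst p \<in> m ` D" if "p \<in> E" for p using that by (auto simp: E_def tl_def)
  then have "strong_pseudo_diagonal_net E ge fst"
    using assms E unfolding strong_pseudo_diagonal_net_def
    by (force intro: lim)
  then show ?thesis unfolding strong_pseudo_amenable_def by blast
qed


section \<open>The algebra of absolutely summable matrices\<close>

text \<open>The index set \<open>I\<close> is the type \<open>'i\<close>; it is non-empty like every HOL type.\<close>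

typedef 'i l1_matrix = "{a :: 'i \<Rightarrow> 'i \<Rightarrow> complex. (\<lambda>(i, j). cmod (a i j)) summable_on UNIV}"
  morphisms entry Abs_l1_matrix
  by (rule exI[of _ "\<lambda>_ _. 0"]) (simp add: case_prod_unfold)

setup_lifting type_definition_l1_matrix

lemma l1_bounded:
  fixes f :: "'b \<Rightarrow> real"
  assumes "\<And>p. 0 \<le> f p" "\<And>F. finite F \<Longrightarrow> sum f F \<le> C"
  shows "f summable_on UNIV" "infsum f UNIV \<le> C"
proof -
  show *: "f summable_on UNIV"
    using assms by (intro nonneg_bdd_above_summable_on) (auto intro!: bdd_aboveI2)
  show "infsum f UNIV \<le> C" by (rule infsum_le_finite_sums[OF *]) (rule assms)
qed

lemma l1_comparison:
  fixes f g :: "'b \<Rightarrow> real"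
  assumes "g summable_on UNIV" "\<And>p. 0 \<le> f p" "\<And>p. f p \<le> g p"
  shows "f summable_on UNIV"
  using assms by (intro summable_on_comparison_test[OF assms(1)]) auto

lemma l1_add:
  assumes "(\<lambda>(i, j). cmod (a i j)) summable_on UNIV" "(\<lambda>(i, j). cmod (b i j)) summable_on UNIV"
  shows "(\<lambda>(i, j). cmod (a i j + b i j)) summable_on UNIV"
    and "(\<lambda>(i, j). cmod (a i j - b i j)) summable_on UNIV"
  by (rule l1_comparison[OF summable_on_add[OF assms]];
      auto simp: norm_triangle_ineq norm_triangle_ineq4)+

lemma l1_mult:
  fixes a b :: "'i \<Rightarrow> 'i \<Rightarrow> complex"
  assumes a: "(\<lambda>(i, j). cmod (a i j)) summable_on UNIV" and b: "(\<lambda>(i, j). cmod (b i j)) summable_on UNIV"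
  shows "(\<lambda>j. a i j * b j k) summable_on UNIV"
    and "(\<lambda>(i, k). cmod (\<Sum>\<^sub>\<infinity>j. a i j * b j k)) summable_on UNIV"
    and "(\<Sum>\<^sub>\<infinity>(i, k). cmod (\<Sum>\<^sub>\<infinity>j. a i j * b j k)) \<le>
      (\<Sum>\<^sub>\<infinity>(i, j). cmod (a i j)) * (\<Sum>\<^sub>\<infinity>(i, j). cmod (b i j))"
proof -
  define G where "G p j = cmod (a (fst p) j * b j (snd p))" for p j
  let ?A = "\<Sum>\<^sub>\<infinity>(i, j). cmod (a i j)" and ?B = "\<Sum>\<^sub>\<infinity>(i, j). cmod (b i j)"
  have fin: "(\<Sum>(p, j)\<in>F. G p j) \<le> ?A * ?B" if F: "finite F" for F
  proof -
    define h where "h = (\<lambda>((i, k), j). ((i, j), (j, k))) ` F"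
    have inj: "inj_on (\<lambda>((i, k), j). ((i, j), (j, k))) F" by (auto simp: inj_on_def)
    have "(\<Sum>(p, j)\<in>F. G p j) = (\<Sum>(p, q)\<in>h. (case p of (i, j) \<Rightarrow> cmod (a i j)) * (case q of (j, k) \<Rightarrow> cmod (b j k)))"
      unfolding h_def by (subst sum.reindex[OF inj]) (auto simp: G_def norm_mult intro!: sum.cong)
    also have "\<dots> \<le> (\<Sum>(p, q)\<in>fst ` h \<times> snd ` h. (case p of (i, j) \<Rightarrow> cmod (a i j)) * (case q of (j, k) \<Rightarrow> cmod (b j k)))"
    proof (rule sum_mono2)
      show "h \<subseteq> fst ` h \<times> snd ` h" by force
    qed (use F in \<open>auto simp: h_def\<close>)
    also have "\<dots> = (\<Sum>(i, j)\<in>fst ` h. cmod (a i j)) * (\<Sum>(i, j)\<in>snd ` h. cmod (b i j))"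
      by (simp add: sum_product sum.cartesian_product)
    also have "\<dots> \<le> ?A * ?B"
      using F by (intro mult_mono finite_sum_le_infsum a b sum_nonneg infsum_nonneg) (auto simp: h_def)
    finally show ?thesis .
  qed
  have G: "(\<lambda>(p, j). G p j) summable_on UNIV \<times> UNIV" "infsum (\<lambda>(p, j). G p j) (UNIV \<times> UNIV) \<le> ?A * ?B"
    using l1_bounded[of "\<lambda>(p, j). G p j" "?A * ?B"] fin by (auto simp: G_def)
  have Gp: "G p summable_on UNIV" for p
    using summable_on_SigmaD1[of G UNIV "\<lambda>_. UNIV" p] G by (auto simp: G_def)
  then show row: "(\<lambda>j. a i j * b j k) summable_on UNIV" for i k
    using abs_summable_summable[of "\<lambda>j. a i j * b j k" UNIV] Gp[of "(i, k)"] by (simp add: G_def[abs_def])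
  have le: "cmod (\<Sum>\<^sub>\<infinity>j. a (fst p) j * b j (snd p)) \<le> infsum (G p) UNIV" for p
    using Gp[of p] unfolding G_def[abs_def] by (rule norm_infsum_bound)
  have S: "(\<lambda>p. infsum (G p) UNIV) summable_on UNIV"
    using summable_on_Sigma_banach[OF G(1)] .
  show *: "(\<lambda>(i, k). cmod (\<Sum>\<^sub>\<infinity>j. a i j * b j k)) summable_on UNIV"
    by (rule l1_comparison[OF S]) (use le in auto)
  have "(\<Sum>\<^sub>\<infinity>(i, k). cmod (\<Sum>\<^sub>\<infinity>j. a i j * b j k)) \<le> (\<Sum>\<^sub>\<infinity>p. infsum (G p) UNIV)"
    by (rule infsum_mono[OF * S]) (use le in auto)
  also have "\<dots> = infsum (\<lambda>(p, j). G p j) (UNIV \<times> UNIV)"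
    by (rule infsum_Sigma'_banach[OF G(1)])
  also have "\<dots> \<le> ?A * ?B" by (rule G)
  finally show "(\<Sum>\<^sub>\<infinity>(i, k). cmod (\<Sum>\<^sub>\<infinity>j. a i j * b j k)) \<le> ?A * ?B" .
qed

instantiation l1_matrix :: (type) complex_normed_algebra
begin

lift_definition zero_l1_matrix :: "'a l1_matrix" is "\<lambda>_ _. 0"
  by (simp add: case_prod_unfold)

lift_definition plus_l1_matrix :: "'a l1_matrix \<Rightarrow> 'a l1_matrix \<Rightarrow> 'a l1_matrix" is
  "\<lambda>a b i j. a i j + b i j"
  by (rule l1_add(1))

lift_definition uminus_l1_matrix :: "'a l1_matrix \<Rightarrow> 'a l1_matrix" is "\<lambda>a i j. - a i j" by simp

lift_definition minus_l1_matrix :: "'a l1_matrix \<Rightarrow> 'a l1_matrix \<Rightarrow> 'a l1_matrix" is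
  "\<lambda>a b i j. a i j - b i j"
  by (rule l1_add(2))

lift_definition scaleC_l1_matrix :: "complex \<Rightarrow> 'a l1_matrix \<Rightarrow> 'a l1_matrix" is "\<lambda>c a i j. c * a i j"
  by (simp add: norm_mult case_prod_unfold summable_on_cmult_right)

lift_definition scaleR_l1_matrix :: "real \<Rightarrow> 'a l1_matrix \<Rightarrow> 'a l1_matrix" is "\<lambda>r a i j. r *\<^sub>R a i j"
  by (simp add: case_prod_unfold summable_on_cmult_right)

lift_definition times_l1_matrix :: "'a l1_matrix \<Rightarrow> 'a l1_matrix \<Rightarrow> 'a l1_matrix" is
  "\<lambda>a b i k. \<Sum>\<^sub>\<infinity>j. a i j * b j k"
  by (rule l1_mult(2))

lift_definition norm_l1_matrix :: "'a l1_matrix \<Rightarrow> real" is "\<lambda>a. \<Sum>\<^sub>\<infinity>(i, j). cmod (a i j)" .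

definition sgn_l1_matrix :: "'a l1_matrix \<Rightarrow> 'a l1_matrix" where
  "sgn_l1_matrix a = scaleR (inverse (norm a)) a"
definition dist_l1_matrix :: "'a l1_matrix \<Rightarrow> 'a l1_matrix \<Rightarrow> real" where
  "dist_l1_matrix a b = norm (a - b)"
definition uniformity_l1_matrix :: "('a l1_matrix \<times> 'a l1_matrix) filter" where
  "uniformity_l1_matrix = (INF e\<in>{0 <..}. principal {(x, y). dist x y < e})"
definition open_l1_matrix :: "'a l1_matrix set \<Rightarrow> bool" where
  "open_l1_matrix S = (\<forall>x\<in>S. \<forall>\<^sub>F (x', y) in uniformity. x' = x \<longrightarrow> y \<in> S)"

instance
proof
  fix a b c :: "'a l1_matrix" and w z :: complex and r s :: real
  show "sgn a = scaleR (inverse (norm a)) a" "dist a b = norm (a - b)"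
    "(uniformity :: ('a l1_matrix \<times> 'a l1_matrix) filter) = (INF e\<in>{0 <..}. principal {(x, y). dist x y < e})"
    by (auto simp: sgn_l1_matrix_def dist_l1_matrix_def uniformity_l1_matrix_def)
  show "open U \<longleftrightarrow> (\<forall>x\<in>U. \<forall>\<^sub>F (x', y) in uniformity. x' = x \<longrightarrow> y \<in> U)" for U :: "'a l1_matrix set"
    by (simp add: open_l1_matrix_def)
  show "a + b + c = a + (b + c)" "a + b = b + a" "0 + a = a" "- a + a = 0" "a - b = a + - b"
    "w *\<^sub>C (a + b) = w *\<^sub>C a + w *\<^sub>C b" "(w + z) *\<^sub>C a = w *\<^sub>C a + z *\<^sub>C a"
    "w *\<^sub>C z *\<^sub>C a = (w * z) *\<^sub>C a" "1 *\<^sub>C a = a" "r *\<^sub>R a = complex_of_real r *\<^sub>C a"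
    "r *\<^sub>R (a + b) = r *\<^sub>R a + r *\<^sub>R b" "(r + s) *\<^sub>R a = r *\<^sub>R a + s *\<^sub>R a"
    "r *\<^sub>R s *\<^sub>R a = (r * s) *\<^sub>R a" "1 *\<^sub>R a = a"
    by (transfer; simp add: algebra_simps scaleR_conv_of_real)+
  show "norm (w *\<^sub>C a) = cmod w * norm a" "norm (r *\<^sub>R a) = \<bar>r\<bar> * norm a"
    by (transfer; simp add: norm_mult case_prod_unfold infsum_cmult_right')+
  show "norm a = 0 \<longleftrightarrow> a = 0"
  proof transfer
    fix a :: "'a \<Rightarrow> 'a \<Rightarrow> complex"
    assume a: "(\<lambda>(i, j). cmod (a i j)) summable_on UNIV"
    have "a = (\<lambda>_ _. 0)" if "(\<Sum>\<^sub>\<infinity>(i, j). cmod (a i j)) = 0"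
    proof (intro ext)
      show "a i j = 0" for i j
        using nonneg_infsum_le_0D[OF _ a, of "(i, j)"] that by auto
    qed
    then show "(\<Sum>\<^sub>\<infinity>(i, j). cmod (a i j)) = 0 \<longleftrightarrow> a = (\<lambda>_ _. 0)"
      by (auto simp: case_prod_unfold)
  qed
  show "norm (a + b) \<le> norm a + norm b"
  proof transfer
    fix a b :: "'a \<Rightarrow> 'a \<Rightarrow> complex"
    assume ab: "(\<lambda>(i, j). cmod (a i j)) summable_on UNIV" "(\<lambda>(i, j). cmod (b i j)) summable_on UNIV"
    have S: "(\<lambda>p. (case p of (i, j) \<Rightarrow> cmod (a i j)) + (case p of (i, j) \<Rightarrow> cmod (b i j))) summable_on UNIV"
      by (rule summable_on_add[OF ab])
    have "(\<Sum>\<^sub>\<infinity>(i, j). cmod (a i j + b i j)) \<le>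
        (\<Sum>\<^sub>\<infinity>p. (case p of (i, j) \<Rightarrow> cmod (a i j)) + (case p of (i, j) \<Rightarrow> cmod (b i j)))"
      by (rule infsum_mono[OF l1_comparison[OF S] S]) (auto simp: norm_triangle_ineq)
    also have "\<dots> = (\<Sum>\<^sub>\<infinity>(i, j). cmod (a i j)) + (\<Sum>\<^sub>\<infinity>(i, j). cmod (b i j))"
      by (rule infsum_add[OF ab])
    finally show "(\<Sum>\<^sub>\<infinity>(i, j). cmod (a i j + b i j)) \<le> \<dots>" .
  qed
  show "norm (a * b) \<le> norm a * norm b" by transfer (rule l1_mult(3))
  show "(a + b) * c = a * c + b * c" "a * (b + c) = a * b + a * c"
    by (transfer; intro ext; simp add: algebra_simps infsum_add l1_mult(1))+
  have L: "(w *\<^sub>C a) * b = w *\<^sub>C (a * b)" and R: "a * (w *\<^sub>C b) = w *\<^sub>C (a * b)" for w and a b :: "'a l1_matrix"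
    by (transfer; intro ext; simp add: algebra_simps infsum_cmult_right')+
  then show "(w *\<^sub>C a) * b = w *\<^sub>C (a * b)" "a * (w *\<^sub>C b) = w *\<^sub>C (a * b)" by auto
  have "r *\<^sub>R a = complex_of_real r *\<^sub>C a" for r and a :: "'a l1_matrix"
    by transfer (simp add: scaleR_conv_of_real)
  then show "(r *\<^sub>R a) * b = r *\<^sub>R (a * b)" "a * (r *\<^sub>R b) = r *\<^sub>R (a * b)" by (auto simp: L R)
  show "a * b * c = a * (b * c)"
  proof transfer
    fix a b c :: "'a \<Rightarrow> 'a \<Rightarrow> complex"
    assume a: "(\<lambda>(i, j). cmod (a i j)) summable_on UNIV"
      and b: "(\<lambda>(i, j). cmod (b i j)) summable_on UNIV"
      and c: "(\<lambda>(i, j). cmod (c i j)) summable_on UNIV"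
    have bd: "cmod (x i j) \<le> (\<Sum>\<^sub>\<infinity>(i, j). cmod (x i j))"
      if "(\<lambda>(i, j). cmod (x i j)) summable_on UNIV" for x :: "'a \<Rightarrow> 'a \<Rightarrow> complex" and i j
      using finite_sum_le_infsum[OF that, of "{(i, j)}"] by auto
    show "(\<lambda>i l. \<Sum>\<^sub>\<infinity>k. (\<Sum>\<^sub>\<infinity>j. a i j * b j k) * c k l) = (\<lambda>i l. \<Sum>\<^sub>\<infinity>j. a i j * (\<Sum>\<^sub>\<infinity>k. b j k * c k l))"
    proof (intro ext)
      fix i l
      let ?K = "(\<Sum>\<^sub>\<infinity>(i, j). cmod (a i j)) * (\<Sum>\<^sub>\<infinity>(i, j). cmod (c i j))"
      have "cmod (a i j * b j k * c k l) \<le> ?K * cmod (b j k)" for j k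
      proof -
        have "cmod (a i j) * cmod (c k l) \<le> ?K"
          by (intro mult_mono bd a c infsum_nonneg) auto
        from mult_right_mono[OF this, of "cmod (b j k)"] show ?thesis
          by (simp add: norm_mult mult.assoc mult.left_commute mult.commute)
      qed
      then have "(\<lambda>p. cmod (a i (fst p) * b (fst p) (snd p) * c (snd p) l)) summable_on UNIV"
        by (intro l1_comparison[OF summable_on_cmult_right[OF b, of ?K]]) (auto simp: case_prod_unfold)
      then have S: "(\<lambda>(j, k). a i j * b j k * c k l) summable_on UNIV \<times> UNIV"
        by (auto simp: case_prod_unfold intro: abs_summable_summable)
      have "(\<Sum>\<^sub>\<infinity>j. a i j * (\<Sum>\<^sub>\<infinity>k. b j k * c k l)) = (\<Sum>\<^sub>\<infinity>j. \<Sum>\<^sub>\<infinity>k. a i j * b j k * c k l)"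
        by (simp add: mult.assoc infsum_cmult_right')
      also have "\<dots> = (\<Sum>\<^sub>\<infinity>k. \<Sum>\<^sub>\<infinity>j. a i j * b j k * c k l)"
        by (rule infsum_swap_banach[OF S])
      also have "\<dots> = (\<Sum>\<^sub>\<infinity>k. (\<Sum>\<^sub>\<infinity>j. a i j * b j k) * c k l)"
        by (simp add: infsum_cmult_left')
      finally show "(\<Sum>\<^sub>\<infinity>k. (\<Sum>\<^sub>\<infinity>j. a i j * b j k) * c k l) = (\<Sum>\<^sub>\<infinity>j. a i j * (\<Sum>\<^sub>\<infinity>k. b j k * c k l))" by simp
    qed
  qed
qed

end

lemma sum_entry_le_norm: "finite F \<Longrightarrow> (\<Sum>(i, j)\<in>F. cmod (entry a i j)) \<le> norm a"
  by transfer (rule finite_sum_le_infsum; auto)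

lemma norm_entry_le: "cmod (entry a i j) \<le> norm a"
  using sum_entry_le_norm[of "{(i, j)}" a] by simp

instance l1_matrix :: (type) complex_banach_algebra
proof
  fix X :: "nat \<Rightarrow> 'a l1_matrix"
  assume X: "Cauchy X"
  have "Cauchy (\<lambda>n. entry (X n) i j)" for i j
  proof (rule metric_CauchyI)
    fix e :: real assume "e > 0"
    from metric_CauchyD[OF X this] obtain M where
      M: "\<And>m n. m \<ge> M \<Longrightarrow> n \<ge> M \<Longrightarrow> norm (X m - X n) < e"
      by (auto simp: dist_norm)
    have "dist (entry (X m) i j) (entry (X n) i j) < e" if "m \<ge> M" "n \<ge> M" for m n
      using norm_entry_le[of "X m - X n" i j] M[OF that]
      by (simp add: dist_norm minus_l1_matrix.rep_eq)
    then show "\<exists>M. \<forall>m\<ge>M. \<forall>n\<ge>M. dist (entry (X m) i j) (entry (X n) i j) < e" by blast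
  qed
  then have "(\<lambda>n. entry (X n) i j) \<longlonglongrightarrow> lim (\<lambda>n. entry (X n) i j)" for i j
    by (simp add: Cauchy_convergent_iff convergent_LIMSEQ_iff)
  then obtain L where L: "\<And>i j. (\<lambda>n. entry (X n) i j) \<longlonglongrightarrow> L i j"
    by (rule that[of "\<lambda>i j. lim (\<lambda>n. entry (X n) i j)"])
  have tail: "(\<lambda>(i, j). cmod (entry (X n) i j - L i j)) summable_on UNIV"
      "(\<Sum>\<^sub>\<infinity>(i, j). cmod (entry (X n) i j - L i j)) \<le> e"
    if N: "\<And>m. m \<ge> N \<Longrightarrow> norm (X n - X m) < e" for n N e
  proof -
    have "(\<Sum>(i, j)\<in>F. cmod (entry (X n) i j - L i j)) \<le> e" if F: "finite F" for F
    proof (rule LIMSEQ_le_const2)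
      show "(\<lambda>m. \<Sum>(i, j)\<in>F. cmod (entry (X n) i j - entry (X m) i j))
          \<longlonglongrightarrow> (\<Sum>(i, j)\<in>F. cmod (entry (X n) i j - L i j))"
        unfolding case_prod_unfold by (intro tendsto_intros L)
      show "\<exists>M. \<forall>m\<ge>M. (\<Sum>(i, j)\<in>F. cmod (entry (X n) i j - entry (X m) i j)) \<le> e"
      proof (intro exI[of _ N] allI impI)
        fix m assume "m \<ge> N"
        from sum_entry_le_norm[OF F, of "X n - X m"] N[OF this]
        show "(\<Sum>(i, j)\<in>F. cmod (entry (X n) i j - entry (X m) i j)) \<le> e"
          by (simp add: minus_l1_matrix.rep_eq)
      qed
    qed
    from l1_bounded[of "\<lambda>(i, j). cmod (entry (X n) i j - L i j)" e, OF _ this]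
    show "(\<lambda>(i, j). cmod (entry (X n) i j - L i j)) summable_on UNIV"
      "(\<Sum>\<^sub>\<infinity>(i, j). cmod (entry (X n) i j - L i j)) \<le> e" by auto
  qed
  obtain N where N: "\<And>m. m \<ge> N \<Longrightarrow> norm (X N - X m) < 1"
    using metric_CauchyD[OF X zero_less_one] by (auto simp: dist_norm)
  have "(\<lambda>(i, j). cmod (L i j)) summable_on UNIV"
  proof (rule l1_comparison[OF summable_on_add[OF tail(1)[OF N] entry[of "X N", simplified]]])
    fix p :: "'a \<times> 'a"
    show "(case p of (i, j) \<Rightarrow> cmod (L i j)) \<le> (case p of (i, j) \<Rightarrow> cmod (entry (X N) i j - L i j))
        + (case p of (i, j) \<Rightarrow> cmod (entry (X N) i j))"
      using norm_triangle_ineq4[of "entry (X N) (fst p) (snd p) - L (fst p) (snd p)" "entry (X N) (fst p) (snd p)"]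
      by (auto simp: case_prod_unfold)
  qed auto
  then have eL: "entry (Abs_l1_matrix L) = L" by (simp add: Abs_l1_matrix_inverse)
  have "X \<longlonglongrightarrow> Abs_l1_matrix L"
  proof (rule metric_LIMSEQ_I)
    fix e :: real assume "e > 0"
    then obtain N where N: "\<And>m n. m \<ge> N \<Longrightarrow> n \<ge> N \<Longrightarrow> norm (X n - X m) < e / 2"
      using metric_CauchyD[OF X, of "e / 2"] by (auto simp: dist_norm)
    have "dist (X n) (Abs_l1_matrix L) < e" if "n \<ge> N" for n
      using tail(2)[of N n "e / 2"] N that \<open>e > 0\<close>
      by (simp add: dist_norm norm_l1_matrix.rep_eq minus_l1_matrix.rep_eq eL)
    then show "\<exists>no. \<forall>n\<ge>no. dist (X n) (Abs_l1_matrix L) < e" by blast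
  qed
  then show "convergent X" by (auto simp: convergent_def)
qed

end

(*
  Infinite index sets: let n = pi**(m_alpha). Since n commutes with the matrix units, all diagonal
  coordinate functionals x |-> x_ii take the same value c at n, and c is near 1 far out in the net.
  The sum of the diagonal coordinates over a finite set F is a functional of norm at most 1, so
  |F| |c| <= ||n|| for all F, which bounds the size of the index set.
  Finite index sets: the sum of E_iz (x) E_zi over all i, for any fixed z, is a diagonal.
*)
theory Submission
  imports Defs
begin

lemma infsum_single:
  assumes "\<And>j. j \<noteq> i \<Longrightarrow> f j = 0"
  shows "infsum f UNIV = f i"
proof -
  have "infsum f UNIV = infsum f {i}"
    by (rule infsum_cong_neutral) (use assms in auto)
  then show ?thesis by simp
qed

lift_definition matrix_unit :: "'i \<Rightarrow> 'i \<Rightarrow> 'i l1_matrix" is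
  "\<lambda>i j k l. if k = i \<and> l = j then 1 else 0"
proof -
  fix i j :: 'i
  have "(\<lambda>(k, l). cmod (if k = i \<and> l = j then 1 else 0)) summable_on {(i, j)}"
    by simp
  then show "(\<lambda>(k, l). cmod (if k = i \<and> l = j then 1 else 0)) summable_on UNIV"
    by (rule summable_on_cong_neutral[THEN iffD1, rotated -1]) (auto split: if_splits)
qed

lemma entry_mult: "entry (a * b) i k = (\<Sum>\<^sub>\<infinity>j. entry a i j * entry b j k)"
  by transfer simp

lemma entry_mult_matrix_unit:
  "entry (a * matrix_unit i j) k l = (if l = j then entry a k i else 0)"
  unfolding entry_mult by (subst infsum_single[of i]) (auto simp: matrix_unit.rep_eq)

lemma entry_matrix_unit_mult:
  "entry (matrix_unit i j * a) k l = (if k = i then entry a j l else 0)"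
  unfolding entry_mult by (subst infsum_single[of j]) (auto simp: matrix_unit.rep_eq)

lemma l1_matrix_eqI: "(\<And>i j. entry a i j = entry b i j) \<Longrightarrow> a = b"
  by transfer auto

lemma entry_sum: "entry (sum f S) i j = (\<Sum>s\<in>S. entry (f s) i j)"
  by (induction S rule: infinite_finite_induct)
    (auto simp: zero_l1_matrix.rep_eq plus_l1_matrix.rep_eq)

text \<open>Column \<open>i\<close> of \<open>a\<close>, moved to column \<open>z\<close> and
  expanded in matrix units. Finiteness of the index type makes this a finite sum, so it can be
  pulled out of a tensor factor.\<close>

lemma mult_matrix_unit_eq_sum:
  fixes a :: "'i l1_matrix"
  assumes "finite (UNIV :: 'i set)"
  shows "a * matrix_unit i z = (\<Sum>k\<in>UNIV. entry a k i *\<^sub>C matrix_unit k z)"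
  by (rule l1_matrix_eqI)
    (auto simp: assms entry_mult_matrix_unit entry_sum scaleC_l1_matrix.rep_eq matrix_unit.rep_eq
      if_distrib cong: if_cong)

lemma matrix_unit_mult_eq_sum:
  fixes a :: "'i l1_matrix"
  assumes "finite (UNIV :: 'i set)"
  shows "matrix_unit z k * a = (\<Sum>i\<in>UNIV. entry a k i *\<^sub>C matrix_unit z i)"
  by (rule l1_matrix_eqI)
    (auto simp: assms entry_matrix_unit_mult entry_sum scaleC_l1_matrix.rep_eq matrix_unit.rep_eq
      if_distrib cong: if_cong)

text \<open>The singleton case is a diagonal coordinate functional. For infinite \<open>F\<close>
  the sum is 0 by convention, so the facts below are stated for finite \<open>F\<close>.\<close>

definition partial_trace :: "'i set \<Rightarrow> 'i l1_matrix cdual" where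
  "partial_trace F = Abs_cdual (Blinfun (\<lambda>a. \<Sum>i\<in>F. entry a i i))"

text \<open>The diagonal entries over \<open>F\<close> are among the entries summed in the l1 norm,
  so the bound is uniform in \<open>F\<close>.\<close>

lemma cmod_sum_diag_le: "finite F \<Longrightarrow> cmod (\<Sum>i\<in>F. entry a i i) \<le> norm a"
proof -
  assume F: "finite F"
  have "cmod (\<Sum>i\<in>F. entry a i i) \<le> (\<Sum>i\<in>F. cmod (entry a i i))" by (rule norm_sum)
  also have "\<dots> = (\<Sum>(i, j)\<in>(\<lambda>i. (i, i)) ` F. cmod (entry a i j))"
    by (subst sum.reindex) (auto simp: inj_on_def)
  also have "\<dots> \<le> norm a" using F by (intro sum_entry_le_norm) auto
  finally show ?thesis .
qed

lemma cdual_apply_partial_trace: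
  assumes "finite F"
  shows "cdual_apply (partial_trace F) a = (\<Sum>i\<in>F. entry a i i)"
proof -
  have "bounded_clinear (\<lambda>a. \<Sum>i\<in>F. entry a i i)"
    by (rule bounded_clinearI[where K = 1])
      (auto simp: plus_l1_matrix.rep_eq scaleC_l1_matrix.rep_eq scaleC_complex_def sum.distrib
        sum_distrib_left cmod_sum_diag_le[OF assms])
  then show ?thesis by (simp add: partial_trace_def cdual_apply_Abs)
qed

lemma norm_partial_trace_le: "finite F \<Longrightarrow> norm (partial_trace F) \<le> 1"
  by (rule norm_cdual_bound) (auto simp: cdual_apply_partial_trace cmod_sum_diag_le)

lemma partial_trace_insert:
  "finite F \<Longrightarrow> i \<notin> F \<Longrightarrow> partial_trace (insert i F) = partial_trace {i} + partial_trace F"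
  by (rule cdual_eqI) (simp add: cdual_apply_partial_trace)

lemma cdual_apply_zero_right: "cdual_apply n 0 = 0"
  using bounded_clinear_cdual_apply[of n] by (simp add: bounded_clinear_def linear_simps)

lemma cdual_apply_add_right: "cdual_apply n (x + y) = cdual_apply n x + cdual_apply n y"
  using bounded_clinear_cdual_apply[of n] by (simp add: bounded_clinear_def linear_simps)

lemma central_bidual_diag:
  fixes n :: "'i l1_matrix cdual cdual"
  assumes "\<And>a. bidual_lmult (*) a n = bidual_rmult (*) n a"
  shows "cdual_apply n (partial_trace {i}) = cdual_apply n (partial_trace {j})"
proof -
  \<comment> \<open>The functional \<open>x \<mapsto> x\<^sub>i\<^sub>j\<close>, moved to the two diagonal positions by the actions of \<open>E\<^sub>i\<^sub>j\<close>.\<close>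
  define \<phi> where "\<phi> = dual_lmult (*) (matrix_unit j i) (partial_trace {i})"
  have \<phi>: "cdual_apply \<phi> x = entry x i j" for x
    by (simp add: \<phi>_def cdual_apply_dual_mult bounded_clinear_mult_right
        cdual_apply_partial_trace entry_mult_matrix_unit)
  have "dual_lmult (*) (matrix_unit i j) \<phi> = partial_trace {i}"
    by (rule cdual_eqI) (simp add: cdual_apply_dual_mult bounded_clinear_mult_right \<phi>
        cdual_apply_partial_trace entry_mult_matrix_unit)
  moreover have "dual_rmult (*) \<phi> (matrix_unit i j) = partial_trace {j}"
    by (rule cdual_eqI) (simp add: cdual_apply_dual_mult bounded_clinear_mult_left \<phi>
        cdual_apply_partial_trace entry_matrix_unit_mult)
  \<comment> \<open>The left action on \<open>n\<close> becomes the right action on \<phi>, giving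
    the value at \<open>partial_trace {j}\<close>; the right action likewise gives the value at
    \<open>partial_trace {i}\<close>.\<close>
  moreover have "cdual_apply (bidual_lmult (*) (matrix_unit i j) n) \<phi> =
      cdual_apply (bidual_rmult (*) n (matrix_unit i j)) \<phi>"
    by (simp add: assms)
  ultimately show ?thesis
    by (simp add: cdual_apply_bidual_mult bounded_clinear_mult_left bounded_clinear_mult_right)
qed

lemma central_bidual_bound:
  fixes n :: "'i l1_matrix cdual cdual" and F :: "'i set"
  assumes "\<And>a. bidual_lmult (*) a n = bidual_rmult (*) n a" "finite F"
  shows "real (card F) * cmod (cdual_apply n (partial_trace {z})) \<le> norm n"
proof -
  \<comment> \<open>Each inserted index contributes the same value, by
    \<open>central_bidual_diag\<close>.\<close>
  have "cdual_apply n (partial_trace F) = of_nat (card F) * cdual_apply n (partial_trace {z})"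
    using assms(2)
  proof induction
    case empty
    have "partial_trace {} = (0 :: 'i l1_matrix cdual)"
      by (rule cdual_eqI) (simp add: cdual_apply_partial_trace)
    then show ?case by (simp add: cdual_apply_zero_right)
  next
    case (insert i F)
    then show ?case
      using central_bidual_diag[OF assms(1), of i z]
      by (simp add: partial_trace_insert[OF insert.hyps] cdual_apply_add_right algebra_simps)
  qed
  then have "real (card F) * cmod (cdual_apply n (partial_trace {z})) = cmod (cdual_apply n (partial_trace F))"
    by (simp add: norm_mult)
  also have "\<dots> \<le> norm n * norm (partial_trace F)" by (rule norm_cdual_apply)
  also have "\<dots> \<le> norm n"
    using mult_left_mono[OF norm_partial_trace_le[OF assms(2)], of "norm n"] by simp
  finally show ?thesis .
qed

lemma finite_if_strong_pseudo_amenable: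
  assumes "strong_pseudo_amenable TYPE('i l1_matrix)"
  shows "finite (UNIV :: 'i set)"
proof (rule ccontr)
  assume inf: "infinite (UNIV :: 'i set)"
  obtain D le and m :: "_ \<Rightarrow> ('i l1_matrix, 'i l1_matrix) proj_tensor cdual cdual"
    where net: "strong_pseudo_diagonal_net
      (D :: (('i l1_matrix, 'i l1_matrix) proj_tensor cdual cdual \<times>
        ('i l1_matrix, 'i l1_matrix) proj_tensor cdual cdual set) set) le m"
    using assms unfolding strong_pseudo_amenable_def by blast
  then have D: "directed_set D le" by (simp add: strong_pseudo_diagonal_net_def)
  \<comment> \<open>An arbitrary index; types are non-empty.\<close>
  define z :: 'i where "z = undefined"
  define E where "E = matrix_unit z z"
  have "((\<lambda>\<alpha>. bidual_rmult (*) (bidual_mult_map (m \<alpha>)) E) \<longlongrightarrow> bidual_embed E) (tails D le)"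
    using net by (simp add: strong_pseudo_diagonal_net_def)
  then have "\<forall>\<^sub>F \<alpha> in tails D le.
      dist (bidual_rmult (*) (bidual_mult_map (m \<alpha>)) E) (bidual_embed E) < 1"
    by (rule tendstoD) simp
  \<comment> \<open>By reflexivity, the start of a tail belongs to that tail and can serve as
    \<alpha>.\<close>
  then obtain \<alpha> where \<alpha>: "\<alpha> \<in> D"
    "dist (bidual_rmult (*) (bidual_mult_map (m \<alpha>)) E) (bidual_embed E) < 1"
    unfolding eventually_tails[OF D] using D by (auto simp: directed_set_def dest: reflp_onD)
  define n where "n = bidual_mult_map (m \<alpha>)"
  have central: "bidual_lmult (*) a n = bidual_rmult (*) n a" for a
    using net \<alpha>(1) by (auto simp: strong_pseudo_diagonal_net_def n_def)
  define c where "c = cdual_apply n (partial_trace {z})"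
  \<comment> \<open>Right multiplication by \<open>E\<close> keeps the entry at
    \<open>(z, z)\<close>. Hence \<open>n\<close> acted on by \<open>E\<close> still takes the value
    \<open>c\<close> at this functional, while the embedded \<open>E\<close> takes the value
    1.\<close>
  have "dual_lmult (*) E (partial_trace {z}) = partial_trace {z}"
    by (rule cdual_eqI) (simp add: cdual_apply_dual_mult bounded_clinear_mult_right E_def
        cdual_apply_partial_trace entry_mult_matrix_unit)
  then have "c - 1 = cdual_apply (bidual_rmult (*) n E - bidual_embed E) (partial_trace {z})"
    by (simp add: cdual_apply_bidual_mult bounded_clinear_mult_right c_def
        cdual_apply_partial_trace E_def matrix_unit.rep_eq)
  also have "cmod \<dots> \<le> norm (bidual_rmult (*) n E - bidual_embed E) * norm (partial_trace {z})"
    by (rule norm_cdual_apply)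
  also have "\<dots> \<le> norm (bidual_rmult (*) n E - bidual_embed E)"
    using mult_left_mono[OF norm_partial_trace_le[of "{z}"]] by fastforce
  also have "\<dots> < 1" using \<alpha>(2) by (simp add: dist_norm n_def)
  finally have "cmod c > 0" by auto
  \<comment> \<open>Since \<open>c\<close> is nonzero, the Archimedean property gives a cardinality
    \<open>N\<close> that violates \<open>central_bidual_bound\<close>.\<close>
  then obtain N where N: "norm n < of_nat N * cmod c" by (rule ex_less_of_nat_mult[THEN exE])
  obtain F :: "'i set" where "finite F" "card F = N"
    using infinite_arbitrarily_large[OF inf] by blast
  with central_bidual_bound[OF central \<open>finite F\<close>, of z] N show False by (simp add: c_def)
qed

lemma tensor_add_left_eq: "(a + a') \<otimes>\<^sub>p b = a \<otimes>\<^sub>p b + a' \<otimes>\<^sub>p b"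
proof -
  have "abs_alg_tensor {#(a + a', b)#} = abs_alg_tensor ({#(a, b)#} + {#(a', b)#})"
    using tensor_add_left[of a a' b] by (simp add: alg_tensor.abs_eq_iff add_mset_commute)
  then show ?thesis by (simp only: tensor_def abs_alg_tensor_add of_alg_tensor_simps)
qed

lemma tensor_add_right_eq: "a \<otimes>\<^sub>p (b + b') = a \<otimes>\<^sub>p b + a \<otimes>\<^sub>p b'"
proof -
  have "abs_alg_tensor {#(a, b + b')#} = abs_alg_tensor ({#(a, b)#} + {#(a, b')#})"
    using tensor_add_right[of a b b'] by (simp add: alg_tensor.abs_eq_iff add_mset_commute)
  then show ?thesis by (simp only: tensor_def abs_alg_tensor_add of_alg_tensor_simps)
qed

lemma tensor_scaleC_swap: "(c *\<^sub>C a) \<otimes>\<^sub>p b = a \<otimes>\<^sub>p (c *\<^sub>C b)"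
  using tensor_scale[of c a b] by (simp add: tensor_def alg_tensor.abs_eq_iff[THEN iffD2])

text \<open>The induction starts at singletons, so additivity alone drives it; the application is to
  the non-empty set \<open>UNIV\<close>.\<close>

lemma tensor_sum_left: "finite S \<Longrightarrow> S \<noteq> {} \<Longrightarrow> sum f S \<otimes>\<^sub>p b = (\<Sum>s\<in>S. f s \<otimes>\<^sub>p b)"
  by (induction S rule: finite_ne_induct) (auto simp: tensor_add_left_eq)

lemma tensor_sum_right: "finite S \<Longrightarrow> S \<noteq> {} \<Longrightarrow> a \<otimes>\<^sub>p sum f S = (\<Sum>s\<in>S. a \<otimes>\<^sub>p f s)"
  by (induction S rule: finite_ne_induct) (auto simp: tensor_add_right_eq)

lemma bounded_clinear_sum: "bounded_clinear T \<Longrightarrow> T (sum f S) = (\<Sum>s\<in>S. T (f s))"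
  by (simp add: bounded_clinear_def linear_sum bounded_linear.linear)

text \<open>The two transpositions cancel on evaluation functionals. With the next two lemmas this
  transfers identities for an element to its image in the bidual.\<close>

lemma bidual_lmult_embed:
  "bounded_clinear (l a) \<Longrightarrow> bidual_lmult l a (bidual_embed x) = bidual_embed (l a x)"
  by (rule cdual_eqI) (simp add: cdual_apply_bidual_mult cdual_apply_dual_mult)

lemma bidual_rmult_embed:
  "bounded_clinear (\<lambda>x. r x a) \<Longrightarrow> bidual_rmult r (bidual_embed x) a = bidual_embed (r x a)"
  by (rule cdual_eqI) (simp add: cdual_apply_bidual_mult cdual_apply_dual_mult)

lemma bidual_mult_map_embed: "bidual_mult_map (bidual_embed x) = bidual_embed (tensor_mult_map x)"
  by (rule cdual_eqI) (simp add: cdual_apply_bidual_mult_map cdual_apply_transposed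
      bounded_clinear_tensor_mult_map)

lemma strong_pseudo_amenable_if_diagonal:
  fixes d :: "('a::complex_banach_algebra, 'a) proj_tensor"
  assumes "\<And>a. tensor_lmult a d = tensor_rmult d a"
    and "\<And>a. a * tensor_mult_map d = a" "\<And>a. tensor_mult_map d * a = a"
  shows "strong_pseudo_amenable TYPE('a)"
proof (rule strong_pseudo_amenableI)
  \<comment> \<open>A constant net over a one-point directed set: both limits reduce to exact
    equalities.\<close>
  show "strong_pseudo_diagonal_net {()} (\<lambda>_ _. True) (\<lambda>_. bidual_embed d)"
    unfolding strong_pseudo_diagonal_net_def
    by (auto simp: bidual_lmult_embed bidual_rmult_embed bidual_mult_map_embed
        bounded_clinear_tensor_lmult bounded_clinear_tensor_rmult bounded_clinear_mult_left
        bounded_clinear_mult_right assms directed_set_def reflp_on_def transp_on_def)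
qed

lemma strong_pseudo_amenable_l1_matrix_finite:
  assumes fin: "finite (UNIV :: 'i set)"
  shows "strong_pseudo_amenable TYPE('i l1_matrix)"
proof -
  define z :: 'i where "z = undefined"
  define d where "d = (\<Sum>i\<in>UNIV. matrix_unit i z \<otimes>\<^sub>p matrix_unit z i)"
  \<comment> \<open>Each product \<open>matrix_unit i z * matrix_unit z i\<close> is
    \<open>matrix_unit i i\<close>, so the sum is the identity matrix.\<close>
  have mult_d: "tensor_mult_map d = (\<Sum>i\<in>UNIV. matrix_unit i i)"
    unfolding d_def bounded_clinear_sum[OF bounded_clinear_tensor_mult_map]
    by (intro sum.cong refl l1_matrix_eqI) (simp add: entry_mult_matrix_unit matrix_unit.rep_eq)
  show ?thesis
  proof (rule strong_pseudo_amenable_if_diagonal)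
    fix a :: "'i l1_matrix"
    have "tensor_lmult a d =
        (\<Sum>i\<in>UNIV. \<Sum>k\<in>UNIV. (entry a k i *\<^sub>C matrix_unit k z) \<otimes>\<^sub>p matrix_unit z i)"
      by (simp add: d_def bounded_clinear_sum[OF bounded_clinear_tensor_lmult]
          mult_matrix_unit_eq_sum fin tensor_sum_left)
    \<comment> \<open>The scalars cross the tensor sign. For fixed \<open>k\<close>, the inner sum
      over \<open>i\<close> then assembles row \<open>k\<close> of \<open>a\<close>, that is
      \<open>matrix_unit z k * a\<close>.\<close>
    also have "\<dots> = (\<Sum>k\<in>UNIV. \<Sum>i\<in>UNIV. matrix_unit k z \<otimes>\<^sub>p (entry a k i *\<^sub>C matrix_unit z i))"
      unfolding tensor_scaleC_swap by (rule sum.swap)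
    also have "\<dots> = tensor_rmult d a"
      by (simp add: d_def bounded_clinear_sum[OF bounded_clinear_tensor_rmult]
          matrix_unit_mult_eq_sum fin tensor_sum_right)
    finally show "tensor_lmult a d = tensor_rmult d a" .
    show "a * tensor_mult_map d = a" "tensor_mult_map d * a = a"
      by (auto simp: mult_d sum_distrib_left sum_distrib_right entry_sum entry_mult_matrix_unit
          entry_matrix_unit_mult fin intro!: l1_matrix_eqI)
  qed
qed

theorem theorem3p3:
  "strong_pseudo_amenable TYPE('i l1_matrix) \<longleftrightarrow> finite (UNIV :: 'i set)"
  using finite_if_strong_pseudo_amenable strong_pseudo_amenable_l1_matrix_finite by blast

end
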